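(* Let $k\in\{1,\dots,n\}$ and suppose that the system $\dot x=f(t,x)$ on $\Omega$ is horizontally contractive w.r.t. a distribution $\mathcal{H}_x=\operatorname{span}\{h^1(x),\dots,h^\ell(x)\}$ with $\ell=n-k+1$. Let $\mathcal{Q}_x=\operatorname{span}\{q^1(x),\dots,q^{k-1}(x)\}$ be the orthogonally complementary vertical distribution, with associated matrices $H(x)\in\mathbb{R}^{n\times(n-k+1)}$ and $Q(x)\in\mathbb{R}^{n\times(k-1)}$, and define $$M(x):=\begin{bmatrix}H^T(x)\\Q^T(x)\end{bmatrix}\in\mathbb{R}^{n\times n}.$$ Assume that for some monotonic vector norm $|\cdot|$ there exist $c_i>0$, $i=1,\dots,6$, such that for all $x\in\Omega$ $$c_1|y|\le|H^T(x)H(x)y|\le c_2|y|,\quad y\in\mathbb{R}^{n-k+1},$$ $$c_3|y|\le|M(x)y|\le c_4|y|,\quad y\in\mathbb{R}^n,$$ $$c_5|y|\le|M^{(k)}(x)y|\le c_6|y|,\quad y\in\mathbb{R}^{\binom nk},$$ where $M^{(k)}(x)$ is the $k$th multiplicative compound of $M(x)$. Furthermore, assume there exists a constant $\gamma_1>1$ such that any two trajectories $x^1(t),x^2(t)$ of the system $\dot x=f(t,x)$ satisfy $$|x^1(t)-x^2(t)|\le\gamma_1|x^1(0)-x^2(0)|\quad\text{for all }t\ge0.$$ Then the system $\dot x=f(t,x)$ is also $k$-contractive on $\Omega$.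
   Context: **System.** $f:\mathbb{R}_+\times\mathbb{R}^n\to\mathbb{R}^n$ is continuously differentiable w.r.t. its second argument, $J(t,x):=\frac{\partial f}{\partial x}(t,x)$. Solutions of $\dot x=f(t,x)$ evolve on a closed and connected $n$-dimensional manifold $\Omega\subseteq\mathbb{R}^n$. For every $a\in\Omega$ there is a unique solution $x(t,a)$ with $x(0,a)=a$, and $x(t,a)\in\Omega$ for all $t\ge0$. The variational system along $x(t,a)$ is $\delta\dot x(t,a)=J(t,x(t,a))\,\delta x(t,a)$, with solution $\delta x(t,a)=\frac{\partial x(t,a)}{\partial a}\delta a$, $\delta a\in T_a\Omega$. **Compound matrices.** For $A\in\mathbb{R}^{n\times m}$ and $k\in\{1,\dots,\min\{n,m\}\}$, the $k$th multiplicative compound $A^{(k)}$ is the $\binom nk\times\binom mk$ matrix of all minors of order $k$ of $A$ in lexicographic order. For $A\in\mathbb{R}^{n\times n}$, the $k$th additive compound is $A^{[k]}:=\frac{d}{d\varepsilon}(I_n+\varepsilon A)^{(k)}\big|_{\varepsilon=0}$. **$k$-contraction.** With $r=\binom nk$, the system $\dot x=f(t,x)$ is $k$-contractive on $\Omega$ if the linear time-varying system $\dot y(t)=J^{[k]}(t,x(t,a))\,y(t)$, $y(t)\in\mathbb{R}^r$ (where $J^{[k]}(t,x):=(J(t,x))^{[k]}$), is uniformly exponentially stable for any $a\in\Omega$: there exist $c\ge1$, $\eta>0$ and a vector norm $|\cdot|$ such that, for every $a\in\Omega$, every solution satisfies $|y(t)|\le ce^{-\eta t}|y(0)|$ for all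 $t\ge0$. **Horizontal/vertical distributions.** For every $x\in\Omega$, $T_x\Omega$ is the orthogonal direct sum of $\mathcal{H}_x=\operatorname{span}\{h^1(x),\dots,h^\ell(x)\}$ and $\mathcal{Q}_x=\operatorname{span}\{q^1(x),\dots,q^{n-\ell}(x)\}$, where $h^i,q^i:\mathbb{R}^n\to\mathbb{R}^n$ are $C^1$. Put $H(x)=[h^1(x)\ \cdots\ h^\ell(x)]$ and $Q(x)=[q^1(x)\ \cdots\ q^{n-\ell}(x)]$, so $H^T(x)Q(x)=0$. Every $\delta x\in T_x\Omega$ is uniquely $\delta x=H(x)\delta x_h+Q(x)\delta x_q$ with $\delta x_h\in\mathbb{R}^\ell$, $\delta x_q\in\mathbb{R}^{n-\ell}$. It is assumed throughout that $H(x)$ and $Q(x)$ are bounded on $\Omega$. If $\ell=n$, $Q$ is empty. **Horizontal contraction.** The system $\dot x=f(t,x)$ is horizontally contractive w.r.t. $\mathcal{H}_x$ if there exist $c\ge1$, $\eta>0$ and a vector norm $|\cdot|$ such that, for every $a\in\Omega$, every solution $\delta x(t,a)=H(x(t,a))\delta x_h(t,a)+Q(x(t,a))\delta x_q(t,a)$ of the variational system satisfies $|\delta x_h(t,a)|\le ce^{-\eta t}|\delta x_h(0,a)|$ for all $t\ge0$. **Norms.** All vector norms under consideration are assumed monotonic: $|x_i|\le|y_i|$ for all $i$ implies $|x|\le|y|$. The same symbol $|\cdot|$ is used for norms on spaces of different dimension. *)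

theory Defs
  imports "HOL-Analysis.Analysis" "Jordan_Normal_Form.DL_Submatrix" "Jordan_Normal_Form.Determinant"
begin

text \<open>
  The state space is \<open>real ^ 'n\<close>, where the linear order on \<open>'n\<close> fixes the order of the
  coordinates. Linear algebra in dimensions that are computed from \<open>n\<close> and \<open>k\<close> (\<open>n - k + 1\<close>,
  \<open>k - 1\<close>, which may be \<open>0\<close>, and \<open>n choose k\<close>) uses the matrices and vectors of
  \<open>Jordan_Normal_Form\<close>. All indices are shifted to start at \<open>0\<close>.
\<close>

unbundle no vec_syntax

hide_type (open) Finite_Cartesian_Product.vec
hide_const (open) Finite_Cartesian_Product.vec Finite_Cartesian_Product.row
  Finite_Cartesian_Product.mat Determinants.det

type_synonym 'n state = "(real, 'n) Finite_Cartesian_Product.vec"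

definition coord :: "nat \<Rightarrow> 'n::{finite,linorder}"
  where "coord i = sorted_list_of_set UNIV ! i"

definition to_vec :: "'n::{finite,linorder} state \<Rightarrow> real Matrix.vec"
  where "to_vec v = Matrix.vec CARD('n) (\<lambda>i. vec_nth v (coord i))"

definition to_mat ::
  "('n::{finite,linorder} state, 'n) Finite_Cartesian_Product.vec \<Rightarrow> real Matrix.mat"
  where "to_mat A =
    Matrix.mat CARD('n) CARD('n) (\<lambda>(i, j). vec_nth (vec_nth A (coord i)) (coord j))"


section \<open>Compound matrices\<close>

text \<open>\<open>subseqs\<close> lists the subsequences containing the head before those omitting it, so the
  following enumeration of the \<open>k\<close>-element subsets of \<open>{0..<n}\<close> is lexicographic.\<close>

definition lex_subsets :: "nat \<Rightarrow> nat \<Rightarrow> nat set list"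
  where "lex_subsets n k = map set (filter (\<lambda>xs. length xs = k) (subseqs [0..<n]))"

definition mult_compound :: "nat \<Rightarrow> real Matrix.mat \<Rightarrow> real Matrix.mat"
  where "mult_compound k A =
    Matrix.mat (dim_row A choose k) (dim_col A choose k)
      (\<lambda>(i, j). Determinant.det
        (submatrix A (lex_subsets (dim_row A) k ! i) (lex_subsets (dim_col A) k ! j)))"

definition add_compound :: "nat \<Rightarrow> real Matrix.mat \<Rightarrow> real Matrix.mat"
  where "add_compound k A =
    Matrix.mat (dim_row A choose k) (dim_row A choose k)
      (\<lambda>(i, j). deriv
        (\<lambda>\<epsilon>. mult_compound k (1\<^sub>m (dim_row A) + \<epsilon> \<cdot>\<^sub>m A) $$ (i, j)) 0)"


section \<open>Monotonic vector norms\<close>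

definition vector_norm :: "nat \<Rightarrow> (real Matrix.vec \<Rightarrow> real) \<Rightarrow> bool"
  where "vector_norm m p \<longleftrightarrow>
    (\<forall>v\<in>carrier_vec m. 0 \<le> p v \<and> (p v = 0 \<longleftrightarrow> v = 0\<^sub>v m)) \<and>
    (\<forall>v\<in>carrier_vec m. \<forall>r. p (r \<cdot>\<^sub>v v) = \<bar>r\<bar> * p v) \<and>
    (\<forall>v\<in>carrier_vec m. \<forall>w\<in>carrier_vec m. p (v + w) \<le> p v + p w)"

definition monotonic_norm :: "nat \<Rightarrow> (real Matrix.vec \<Rightarrow> real) \<Rightarrow> bool"
  where "monotonic_norm m p \<longleftrightarrow> vector_norm m p \<and>
    (\<forall>v\<in>carrier_vec m. \<forall>w\<in>carrier_vec m.
      (\<forall>i<m. \<bar>v $ i\<bar> \<le> \<bar>w $ i\<bar>) \<longrightarrow> p v \<le> p w)"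


section \<open>Manifolds and tangent spaces\<close>

text \<open>Topological manifolds of full dimension in \<open>real ^ 'n\<close>, possibly with boundary. Without
  boundary, the only closed and connected examples would be the empty set and the whole space.\<close>

definition full_dim_manifold :: "(real ^ 'n) set \<Rightarrow> bool"
  where "full_dim_manifold \<Omega> \<longleftrightarrow>
    (\<forall>z\<in>\<Omega>. \<exists>U V i. z \<in> U \<and> openin (top_of_set \<Omega>) U \<and>
      openin (top_of_set {v :: real ^ 'n. 0 \<le> vec_nth v i}) V \<and> U homeomorphic V)"

text \<open>At a boundary point, the velocities of curves in \<open>\<Omega>\<close> form only a cone; the tangent space is
  its linear span.\<close>

definition tangent_space :: "(real ^ 'n) set \<Rightarrow> real ^ 'n \<Rightarrow> (real ^ 'n) set"
  where "tangent_space \<Omega> z = span {v. \<exists>c :: real \<Rightarrow> real ^ 'n. c 0 = z \<and>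
    (\<forall>s\<in>{0..1}. c s \<in> \<Omega>) \<and> (c has_vector_derivative v) (at 0 within {0..1})}"


section \<open>The system and its variational system\<close>

definition C1_field :: "(real ^ 'n \<Rightarrow> real ^ 'n) \<Rightarrow> bool"
  where "C1_field g \<longleftrightarrow>
    (\<forall>z. g differentiable (at z)) \<and> continuous_on UNIV (\<lambda>z. jacobian g (at z))"

text \<open>The partial derivative with respect to the state is continuous on
  \<open>{0..} \<times> UNIV\<close>, i.e. jointly in time and state.\<close>

definition C1_in_state :: "(real \<Rightarrow> real ^ 'n \<Rightarrow> real ^ 'n) \<Rightarrow> bool"
  where "C1_in_state f \<longleftrightarrow>
    (\<forall>t\<ge>0. \<forall>z. f t differentiable (at z)) \<and>
    continuous_on ({0..} \<times> UNIV) (\<lambda>(t, z). jacobian (f t) (at z))"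

definition trajectory :: "(real \<Rightarrow> real ^ 'n \<Rightarrow> real ^ 'n) \<Rightarrow> (real \<Rightarrow> real ^ 'n) \<Rightarrow> bool"
  where "trajectory f \<phi> \<longleftrightarrow>
    (\<forall>t\<ge>0. (\<phi> has_vector_derivative f t (\<phi> t)) (at t within {0..}))"

definition solution_map ::
  "(real \<Rightarrow> real ^ 'n \<Rightarrow> real ^ 'n) \<Rightarrow> (real ^ 'n) set \<Rightarrow> (real \<Rightarrow> real ^ 'n \<Rightarrow> real ^ 'n) \<Rightarrow> bool"
  where "solution_map f \<Omega> x \<longleftrightarrow> (\<forall>a\<in>\<Omega>.
    trajectory f (\<lambda>t. x t a) \<and> x 0 a = a \<and> (\<forall>t\<ge>0. x t a \<in> \<Omega>) \<and>
    (\<forall>\<phi>. trajectory f \<phi> \<and> \<phi> 0 = a \<longrightarrow> (\<forall>t\<ge>0. \<phi> t = x t a)))"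

definition variational_solution ::
  "(real \<Rightarrow> real ^ 'n \<Rightarrow> real ^ 'n) \<Rightarrow> (real \<Rightarrow> real ^ 'n) \<Rightarrow> (real \<Rightarrow> real ^ 'n) \<Rightarrow> bool"
  where "variational_solution f \<phi> \<delta> \<longleftrightarrow>
    (\<forall>t\<ge>0. (\<delta> has_vector_derivative jacobian (f t) (at (\<phi> t)) *v \<delta> t) (at t within {0..}))"


section \<open>\<open>k\<close>-contraction\<close>

definition compound_solution ::
  "nat \<Rightarrow> (real \<Rightarrow> 'n::{finite,linorder} state \<Rightarrow> 'n state) \<Rightarrow> (real \<Rightarrow> 'n state) \<Rightarrow>
    (real \<Rightarrow> real Matrix.vec) \<Rightarrow> bool"
  where "compound_solution k f \<phi> y \<longleftrightarrow> (\<forall>t\<ge>0.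
    y t \<in> carrier_vec (CARD('n) choose k) \<and>
    (\<forall>i < CARD('n) choose k. ((\<lambda>s. y s $ i) has_real_derivative
      (add_compound k (to_mat (jacobian (f t) (at (\<phi> t)))) *\<^sub>v y t) $ i) (at t within {0..})))"

definition k_contractive ::
  "nat \<Rightarrow> (real \<Rightarrow> 'n::{finite,linorder} state \<Rightarrow> 'n state) \<Rightarrow> 'n state set \<Rightarrow>
    (real \<Rightarrow> 'n state \<Rightarrow> 'n state) \<Rightarrow> bool"
  where "k_contractive k f \<Omega> x \<longleftrightarrow>
    (\<exists>c\<ge>1. \<exists>\<eta>>0. \<exists>p. monotonic_norm (CARD('n) choose k) p \<and>
      (\<forall>a\<in>\<Omega>. \<forall>y. compound_solution k f (\<lambda>t. x t a) y \<longrightarrow>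
        (\<forall>t\<ge>0. p (y t) \<le> c * exp (- \<eta> * t) * p (y 0))))"


section \<open>Horizontal contraction\<close>

definition field_matrix ::
  "nat \<Rightarrow> (nat \<Rightarrow> 'n::{finite,linorder} state \<Rightarrow> 'n state) \<Rightarrow> 'n state \<Rightarrow> real Matrix.mat"
  where "field_matrix m g z = mat_of_cols CARD('n) (map (\<lambda>i. to_vec (g i z)) [0..<m])"

definition decomposes ::
  "nat \<Rightarrow> (nat \<Rightarrow> 'n::{finite,linorder} state \<Rightarrow> 'n state) \<Rightarrow> (nat \<Rightarrow> 'n state \<Rightarrow> 'n state) \<Rightarrow>
    'n state \<Rightarrow> 'n state \<Rightarrow> real Matrix.vec \<Rightarrow> real Matrix.vec \<Rightarrow> bool"
  where "decomposes l h q z v v\<^sub>h v\<^sub>q \<longleftrightarrow>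
    v\<^sub>h \<in> carrier_vec l \<and> v\<^sub>q \<in> carrier_vec (CARD('n) - l) \<and>
    to_vec v = field_matrix l h z *\<^sub>v v\<^sub>h + field_matrix (CARD('n) - l) q z *\<^sub>v v\<^sub>q"

definition horizontal_vertical ::
  "'n::{finite,linorder} state set \<Rightarrow> nat \<Rightarrow> (nat \<Rightarrow> 'n state \<Rightarrow> 'n state) \<Rightarrow>
    (nat \<Rightarrow> 'n state \<Rightarrow> 'n state) \<Rightarrow> bool"
  where "horizontal_vertical \<Omega> l h q \<longleftrightarrow>
    (\<forall>i<l. C1_field (h i) \<and> bounded (h i ` \<Omega>)) \<and>
    (\<forall>j<CARD('n) - l. C1_field (q j) \<and> bounded (q j ` \<Omega>)) \<and>
    (\<forall>z\<in>\<Omega>.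
      (\<forall>i<l. \<forall>j<CARD('n) - l. inner (h i z) (q j z) = 0) \<and>
      tangent_space \<Omega> z = {u + w |u w. u \<in> span ((\<lambda>i. h i z) ` {..<l}) \<and>
        w \<in> span ((\<lambda>j. q j z) ` {..<CARD('n) - l})} \<and>
      (\<forall>v\<in>tangent_space \<Omega> z. \<exists>!(v\<^sub>h, v\<^sub>q). decomposes l h q z v v\<^sub>h v\<^sub>q))"

definition horizontally_contractive ::
  "(real \<Rightarrow> 'n::{finite,linorder} state \<Rightarrow> 'n state) \<Rightarrow> 'n state set \<Rightarrow>
    (real \<Rightarrow> 'n state \<Rightarrow> 'n state) \<Rightarrow> nat \<Rightarrow> (nat \<Rightarrow> 'n state \<Rightarrow> 'n state) \<Rightarrow>
    (nat \<Rightarrow> 'n state \<Rightarrow> 'n state) \<Rightarrow> bool"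
  where "horizontally_contractive f \<Omega> x l h q \<longleftrightarrow>
    (\<exists>c\<ge>1. \<exists>\<eta>>0. \<exists>p. monotonic_norm l p \<and>
      (\<forall>a\<in>\<Omega>. \<forall>\<delta> \<delta>\<^sub>h \<delta>\<^sub>q. variational_solution f (\<lambda>t. x t a) \<delta> \<and>
        (\<forall>t\<ge>0. decomposes l h q (x t a) (\<delta> t) (\<delta>\<^sub>h t) (\<delta>\<^sub>q t)) \<longrightarrow>
        (\<forall>t\<ge>0. p (\<delta>\<^sub>h t) \<le> c * exp (- \<eta> * t) * p (\<delta>\<^sub>h 0))))"

end

theory Submission
  imports Defs
begin

text \<open>Let \<open>\<Phi>(t)\<close> be the fundamental matrix of the variational system along the trajectory from \<open>a\<close>, with
\<open>\<Phi>(0) = I\<close>. The multiplicative compound is multiplicative (\<open>Cauchy_Binet\<close>, \<open>mult_compound_mult\<close>) and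
the additive compound is its derivative at the identity, so \<open>\<Phi>\<^bsup>(k)\<^esup>(t) y(0)\<close> solves the compound system;
by uniqueness every solution has this form (\<open>compound_system_solution\<close>). Multiplicativity once
more gives \<open>M\<^bsup>(k)\<^esup> y(t) = (M \<Phi>)\<^bsup>(k)\<^esup>(t) y(0)\<close>, with \<open>M\<close> evaluated at \<open>x(t, a)\<close>. As \<open>M\<^bsup>(k)\<^esup>\<close> is bounded
below on \<open>\<Omega>\<close>, it suffices that all minors of order \<open>k\<close> of \<open>M \<Phi>\<close> decay exponentially.

The first \<open>n - k + 1\<close> rows of \<open>M \<Phi>\<close> are \<open>H\<^sup>T \<Phi>\<close>. Each column of \<open>\<Phi>\<close> is a variational solution
\<open>H \<delta>\<^sub>h + Q \<delta>\<^sub>q\<close>, and orthogonality of the two distributions reduces \<open>H\<^sup>T\<close> of it to \<open>H\<^sup>T H \<delta>\<^sub>h\<close>, which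
decays because \<open>\<delta>\<^sub>h\<close> does and \<open>H\<^sup>T H\<close> is bounded above and below (\<open>horizontal_projection_decay\<close>).
The other \<open>k - 1\<close> rows are merely bounded. A minor of order \<open>k\<close> selects \<open>k\<close> rows, hence at least
one of the decaying ones, so by the Leibniz formula it decays at the same rate
(\<open>abs_mult_compound_le_small_rows\<close>).

That \<open>\<Phi>\<close> is bounded uniformly in \<open>a\<close> is the infinitesimal form of the Lipschitz bound on
trajectories (\<open>variational_solution_norm_le\<close>): a variational solution is the limit of difference
quotients of two trajectories. For this both initial points must lie in \<open>\<Omega>\<close> and differ by a
prescribed direction, which is possible arbitrarily close to every point of \<open>\<Omega>\<close> because, by
invariance of domain, the interior of a full-dimensional manifold is dense in it. The Lipschitz
bound also keeps the two trajectories close to the reference one, so that linearising along the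
reference trajectory costs only a small error, which a Gronwall estimate controls.

All constants depend only on the norms and on the constants in the hypotheses, never on \<open>a\<close>; this
makes the resulting decay uniform.\<close>

section \<open>Gronwall estimate and linear differential equations\<close>

lemma norm_matrix_vector_mult_le:
  fixes A :: "real^'m^'n"
  shows "norm (A *v u) \<le> norm A * norm u"
proof -
  have "norm (A *v u) = L2_set (\<lambda>i. norm (inner (vec_nth A i) u)) UNIV"
    by (simp add: norm_vec_def matrix_vector_mul_component)
  also have "\<dots> \<le> L2_set (\<lambda>i. norm (vec_nth A i) * norm u) UNIV"
    by (intro L2_set_mono) (simp_all add: Cauchy_Schwarz_ineq2)
  also have "\<dots> = norm A * norm u"
    by (simp add: norm_vec_def L2_set_left_distrib)
  finally show ?thesis .
qed

lemma bounded_bilinear_matrix_vector_mult: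
  "bounded_bilinear ((*v) :: real^'m^'n \<Rightarrow> real^'m \<Rightarrow> real^'n)"
proof
  show "\<exists>K. \<forall>(A::real^'m^'n) u. norm (A *v u) \<le> norm A * norm u * K"
    using norm_matrix_vector_mult_le by (metis mult.right_neutral)
qed (simp_all add: matrix_vector_mult_add_rdistrib matrix_vector_right_distrib
  scaleR_matrix_vector_assoc matrix_vector_mult_scaleR)

lemma at_within_nonneg_eq_at_within_Icc:
  fixes t T :: real
  assumes "0 \<le> t" "t < T"
  shows "at t within {0..} = at t within {0..T}"
proof (rule at_within_nhd[of t "{..<T}"])
  show "{0..} \<inter> {..<T} - {t} = {0..T} \<inter> {..<T} - {t}" by auto
qed (use assms in auto)

text \<open>The function \<open>E(t) exp (- c t) - d t\<close> is nonincreasing, since its derivative is at most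
\<open>d exp (- c t) - d\<close>, which is nonpositive for \<open>t \<ge> 0\<close>. With
\<open>E(0) = 0\<close> this form gives both uniqueness (\<open>d = 0\<close>) and an error
proportional to the perturbation \<open>d\<close>.\<close>

lemma gronwall:
  fixes E :: "real \<Rightarrow> real"
  assumes deriv: "\<And>t. t \<in> {0..T} \<Longrightarrow> (E has_real_derivative E' t) (at t within {0..T})"
    and le: "\<And>t. t \<in> {0..T} \<Longrightarrow> E' t \<le> c * E t + d"
    and "E 0 = 0" "0 \<le> T" "0 \<le> c" "0 \<le> d"
  shows "E T \<le> d * T * exp (c * T)"
proof (cases "T = 0")
  case False
  define G where "G = (\<lambda>t. E t * exp (- c * t) - d * t)"
  have G': "(G has_real_derivative (E' t - c * E t) * exp (- c * t) - d) (at t within {0..T})"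
    if "t \<in> {0..T}" for t
    unfolding G_def using deriv[OF that]
    by (auto intro!: derivative_eq_intros simp: algebra_simps)
  obtain s where s: "s \<in> {0<..<T}" "G T - G 0 = (T - 0) * ((E' s - c * E s) * exp (- c * s) - d)"
    using mvt_simple[of 0 T G "\<lambda>t u. u * ((E' t - c * E t) * exp (- c * t) - d)"] G' False \<open>0 \<le> T\<close>
    by (auto simp: has_field_derivative_def mult.commute[of _ "_ - d"])
  have "(E' s - c * E s) * exp (- c * s) \<le> d * exp (- c * s)"
    using le[of s] s(1) by (intro mult_right_mono) auto
  also have "\<dots> \<le> d * 1"
    using s(1) assms by (intro mult_left_mono) auto
  finally have "G T \<le> G 0"
    using s(2) \<open>0 \<le> T\<close> mult_nonneg_nonpos[of "T - 0" "(E' s - c * E s) * exp (- c * s) - d"] by linarith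
  then have "E T * exp (- c * T) \<le> d * T"
    using \<open>E 0 = 0\<close> by (simp add: G_def)
  then have "E T * exp (- c * T) * exp (c * T) \<le> d * T * exp (c * T)"
    by (rule mult_right_mono) simp
  then show ?thesis
    by (simp add: mult.assoc flip: exp_add)
qed (use assms in auto)

lemma continuous_on_compact_norm_bound:
  fixes g :: "'a::topological_space \<Rightarrow> 'b::real_normed_vector"
  assumes "compact S" "continuous_on S g"
  obtains K where "0 \<le> K" "\<And>s. s \<in> S \<Longrightarrow> norm (g s) \<le> K"
proof -
  have "bounded (g ` S)"
    using assms by (intro compact_imp_bounded compact_continuous_image)
  then obtain K where "\<forall>y\<in>g ` S. norm y \<le> K" unfolding bounded_iff by (elim exE)
  then show ?thesis using that[of "max 0 K"] by fastforce
qed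

text \<open>The Picard iterates \<open>X\<^sub>0 = v\<close>, \<open>X\<^sub>m\<^sub>+\<^sub>1(t) = \<integral>\<^sub>0\<^sup>t A X\<^sub>m\<close> satisfy \<open>|X\<^sub>m(t)| \<le> |v| (K t)\<^sup>m / m!\<close> wherever
\<open>|A| \<le> K\<close>. Their sum therefore converges on the whole half-line and may be differentiated term by
term on every compact interval.\<close>

lemma linear_ode_solution_exists:
  fixes A :: "real \<Rightarrow> real^'n^'n"
  assumes cont: "continuous_on {0..} A"
  obtains \<delta> where "\<delta> 0 = v"
    "\<And>t. 0 \<le> t \<Longrightarrow> (\<delta> has_vector_derivative A t *v \<delta> t) (at t within {0..})"
proof -
  define X where "X = rec_nat (\<lambda>_::real. v) (\<lambda>_ u t. integral {0..t} (\<lambda>s. A s *v u s))"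
  have X0: "X 0 = (\<lambda>_. v)"
    and XS: "X (Suc m) = (\<lambda>t. integral {0..t} (\<lambda>s. A s *v X m s))" for m
    by (simp_all add: X_def)
  have contA: "continuous_on {0..T} (\<lambda>s. A s *v u s)" if "continuous_on {0..T} u" for u T
    using bounded_bilinear.continuous_on[OF bounded_bilinear_matrix_vector_mult
        continuous_on_subset[OF cont] that] by auto
  have derX': "(X (Suc m) has_vector_derivative A t *v X m t) (at t within {0..T})"
    if "continuous_on {0..T} (X m)" "t \<in> {0..T}" for m t T
    unfolding XS using integral_has_vector_derivative[OF contA[OF that(1)] that(2)] .
  have contX: "continuous_on {0..T} (X m)" for m T
  proof (induct m)
    case (Suc m)
    then show ?case
      using derX' by (meson continuous_on_vector_derivative)
  qed (simp add: X0)
  note derX = derX'[OF contX]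
  have X_at_0: "X m 0 = (if m = 0 then v else 0)" for m
    by (cases m) (simp_all add: X0 XS)
  define \<delta> where "\<delta> = (\<lambda>t. \<Sum>m. X m t)"
  \<comment> \<open>the derivatives of the iterates; the constant iterate \<open>X 0\<close> has derivative \<open>0\<close>\<close>
  define dX where "dX = (\<lambda>m t. case m of 0 \<Rightarrow> 0 | Suc j \<Rightarrow> A t *v X j t)"
  have main: "(\<delta> has_vector_derivative A t *v \<delta> t) (at t within {0..T})"
    if T: "0 \<le> T" and t: "t \<in> {0..T}" for t T
  proof -
    obtain K where K: "0 \<le> K" "\<And>s. s \<in> {0..T} \<Longrightarrow> norm (A s) \<le> K"
      using continuous_on_compact_norm_bound[of "{0..T}" A] continuous_on_subset[OF cont] by auto
    have AX: "norm (A s *v u) \<le> K * B" if "s \<in> {0..T}" "norm u \<le> B" for s u B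
      using norm_matrix_vector_mult_le[of "A s" u] K that
      by (meson mult_mono norm_ge_zero order_trans)
    have bnd: "norm (X m s) \<le> norm v * (K * s) ^ m / fact m" if "s \<in> {0..T}" for m s
      using that
    proof (induct m arbitrary: s)
      case (Suc m)
      let ?g = "\<lambda>r. K * (norm v * (K * r) ^ m / fact m)"
      let ?G = "\<lambda>r. norm v * (K * r) ^ Suc m / fact (Suc m)"
      have G: "(?g has_integral (?G s - ?G 0)) {0..s}"
      proof (rule fundamental_theorem_of_calculus)
        fix r
        have "(?G has_real_derivative norm v * (real (Suc m) * (K * r) ^ m * K) / fact (Suc m))
            (at r within {0..s})"
          by (rule derivative_eq_intros refl | simp)+
        also have "norm v * (real (Suc m) * (K * r) ^ m * K) / fact (Suc m) = ?g r"
          by (simp add: fact_Suc field_simps del: of_nat_Suc)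
        finally show "(?G has_vector_derivative ?g r) (at r within {0..s})"
          by (simp add: has_real_derivative_iff_has_vector_derivative)
      qed (use Suc in auto)
      have "norm (X (Suc m) s) \<le> integral {0..s} ?g"
        unfolding XS
      proof (rule integral_norm_bound_integral)
        show "(\<lambda>r. A r *v X m r) integrable_on {0..s}"
          by (intro integrable_continuous_real contA contX)
        show "?g integrable_on {0..s}" using G by blast
        show "norm (A r *v X m r) \<le> ?g r" if "r \<in> {0..s}" for r
          using that Suc by (intro AX) auto
      qed
      also have "\<dots> = ?G s" using integral_unique[OF G] by simp
      finally show ?case .
    qed (simp add: X0)
    define B where "B = (\<lambda>m. norm v * (K * T) ^ m / fact m)"
    have bndT: "norm (X m s) \<le> B m" if "s \<in> {0..T}" for m s
    proof -
      have "norm v * (K * s) ^ m / fact m \<le> B m"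
        using that K unfolding B_def by (intro divide_right_mono mult_left_mono power_mono) auto
      then show ?thesis using bnd[OF that, of m] by linarith
    qed
    have sumB: "summable B"
      using summable_mult[OF summable_exp[of "K * T"], of "norm v"]
      by (simp add: B_def field_simps)
    have sumX: "summable (\<lambda>m. X m s)" if "s \<in> {0..T}" for s
      using summable_comparison_test'[OF sumB, of 0 "\<lambda>m. X m s"] bndT[OF that] by auto
    define M where "M = (\<lambda>m. case m of 0 \<Rightarrow> 0 | Suc j \<Rightarrow> K * B j)"
    have sumM: "summable M"
      by (subst summable_Suc_iff[symmetric]) (simp add: M_def sumB summable_mult del: summable_cmult_iff)
    have dXM: "norm (dX m s) \<le> M m" if "s \<in> {0..T}" for m s
      by (cases m) (auto simp: dX_def M_def intro!: AX bndT that)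
    have dX_sums: "(\<Sum>m. dX m s) = A s *v \<delta> s" if s: "s \<in> {0..T}" for s
    proof -
      interpret L: bounded_linear "(*v) (A s)"
        by (rule bounded_bilinear.bounded_linear_right[OF bounded_bilinear_matrix_vector_mult])
      have "(\<lambda>m. A s *v X m s) sums (A s *v \<delta> s)"
        unfolding \<delta>_def by (rule L.sums[OF summable_sums[OF sumX[OF s]]])
      then have "(\<lambda>m. dX (Suc m) s) sums (A s *v \<delta> s)" by (simp add: dX_def)
      then have "(\<lambda>m. dX m s) sums (A s *v \<delta> s)"
        by (subst (asm) sums_Suc_iff) (simp add: dX_def)
      then show ?thesis by (simp add: sums_iff)
    qed
    have ul: "uniform_limit {0..T} (\<lambda>n s. \<Sum>i<n. dX i s) (\<lambda>s. A s *v \<delta> s) sequentially"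
      using Weierstrass_m_test[of "{0..T}" dX M, OF dXM sumM]
      by (simp add: uniform_limit_iff dX_sums)
    have "\<exists>g. \<forall>s\<in>{0..T}. (\<lambda>n. X n s) sums g s \<and>
        (g has_derivative (\<lambda>h. h *\<^sub>R (A s *v \<delta> s))) (at s within {0..T})"
    proof (rule has_derivative_series[where x = 0])
      show "(X n has_derivative (\<lambda>h. h *\<^sub>R dX n s)) (at s within {0..T})" if "s \<in> {0..T}" for n s
        using derX[of s T] that
        by (cases n) (auto simp: dX_def X0 has_vector_derivative_def)
      show "\<forall>\<^sub>F n in sequentially. \<forall>s\<in>{0..T}. \<forall>h.
          norm ((\<Sum>i<n. h *\<^sub>R dX i s) - h *\<^sub>R (A s *v \<delta> s)) \<le> e * norm h" if "0 < e" for e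
        using uniform_limitD[OF ul that]
      proof eventually_elim
        case (elim n)
        show ?case
        proof (intro ballI allI)
          fix s h assume "s \<in> {0..T}"
          with elim have "norm ((\<Sum>i<n. dX i s) - A s *v \<delta> s) \<le> e"
            by (auto simp: dist_norm less_imp_le)
          then have "norm (h *\<^sub>R ((\<Sum>i<n. dX i s) - A s *v \<delta> s)) \<le> \<bar>h\<bar> * e"
            by (simp add: mult_left_mono)
          then show "norm ((\<Sum>i<n. h *\<^sub>R dX i s) - h *\<^sub>R (A s *v \<delta> s)) \<le> e * norm h"
            by (simp add: scaleR_diff_right scaleR_sum_right mult.commute)
        qed
      qed
      show "(\<lambda>n. X n 0) sums (\<Sum>n. X n 0)" using sumX T by (auto intro: summable_sums)
    qed (use T in auto)
    then obtain g where g: "\<And>s. s \<in> {0..T} \<Longrightarrow> g s = \<delta> s"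
      "\<And>s. s \<in> {0..T} \<Longrightarrow> (g has_vector_derivative A s *v \<delta> s) (at s within {0..T})"
      unfolding \<delta>_def has_vector_derivative_def by (metis sums_unique)
    show ?thesis
      using has_vector_derivative_transform[OF t _ g(2)[OF t]] g(1) by metis
  qed
  have "(\<delta> has_vector_derivative A t *v \<delta> t) (at t within {0..})" if "0 \<le> t" for t
    using main[of "t + 1" t] that at_within_nonneg_eq_at_within_Icc[of t "t + 1"] by simp
  moreover have "\<delta> 0 = v"
    unfolding \<delta>_def X_at_0 by (rule sums_unique[symmetric]) (rule sums_If_finite_set[of "{0}", simplified])
  ultimately show ?thesis using that by blast
qed

section \<open>Variational solutions and the Lipschitz constant of the flow\<close>

text \<open>In a chart, a point is a limit of points off the boundary hyperplane of the half-space. Near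
such points the inverse chart is injective and continuous on an open set of the full dimension, so
its image is open by invariance of domain.\<close>

lemma full_dim_manifold_subset_closure_interior:
  fixes \<Omega> :: "(real^'n) set"
  assumes "full_dim_manifold \<Omega>"
  shows "\<Omega> \<subseteq> closure (interior \<Omega>)"
proof
  fix z assume "z \<in> \<Omega>"
  obtain U V i where z: "z \<in> U" and U: "openin (top_of_set \<Omega>) U"
    and V: "openin (top_of_set {v :: real^'n. 0 \<le> vec_nth v i}) V" and "U homeomorphic V"
    using assms[unfolded full_dim_manifold_def, rule_format, OF \<open>z \<in> \<Omega>\<close>]
    by blast
  obtain g p where gp: "homeomorphism V U g p"
    using \<open>U homeomorphic V\<close>[unfolded homeomorphic_sym[of U]] by (auto simp: homeomorphic_def)
  obtain W where W: "open W" "V = {v. 0 \<le> vec_nth v i} \<inter> W"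
    using V by (auto simp: openin_open)
  define V' where "V' = W \<inter> {v. 0 < vec_nth v i}"
  have "V' \<subseteq> V" unfolding V'_def W by auto
  have "open (g ` V')"
  proof (rule invariance_of_domain)
    show "continuous_on V' g" "inj_on g V'"
      using gp \<open>V' \<subseteq> V\<close>
      by (auto simp: homeomorphism_def intro: continuous_on_subset inj_on_subset inj_on_inverseI)
    show "open V'"
      unfolding V'_def using W(1) by (intro open_Int open_halfspace_component_gt_cart) (simp_all add: open_halfspace_component_gt_cart)
  qed
  moreover have "g ` V' \<subseteq> \<Omega>"
    using gp \<open>V' \<subseteq> V\<close> U by (auto simp: homeomorphism_def dest: openin_imp_subset)
  ultimately have "g ` V' \<subseteq> interior \<Omega>" by (rule interior_maximal[rotated])
  define w where "w = p z"
  define u where "u = (\<lambda>m::nat. w + (1 / real (Suc m)) *\<^sub>R axis i 1)"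
  have w: "w \<in> V" "g w = z" using gp z by (auto simp: w_def homeomorphism_def)
  have "u \<longlonglongrightarrow> w + 0 *\<^sub>R axis i 1"
    unfolding u_def by (intro tendsto_intros LIMSEQ_Suc[OF lim_1_over_n])
  then have u: "u \<longlonglongrightarrow> w" by simp
  then have "\<forall>\<^sub>F m in sequentially. u m \<in> W"
    using w(1) W by (intro topological_tendstoD) auto
  then have uV': "\<forall>\<^sub>F m in sequentially. u m \<in> V'"
  proof eventually_elim
    case (elim m)
    then show ?case
      using w(1) W(2) by (auto simp: V'_def u_def intro: add_nonneg_pos)
  qed
  have "\<forall>\<^sub>F m in sequentially. u m \<in> V"
    using uV' \<open>V' \<subseteq> V\<close> by (auto elim!: eventually_mono)
  then have "(\<lambda>m. g (u m)) \<longlonglongrightarrow> z"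
    using continuous_on_tendsto_compose[OF homeomorphism_cont1[OF gp] u w(1)] w(2) by simp
  moreover have "\<forall>\<^sub>F m in sequentially. g (u m) \<in> closure (interior \<Omega>)"
    using uV' \<open>g ` V' \<subseteq> interior \<Omega>\<close> closure_subset by (auto elim!: eventually_mono)
  ultimately show "z \<in> closure (interior \<Omega>)"
    using Lim_in_closed_set[of "closure (interior \<Omega>)"] by (metis closed_closure sequentially_bot)
qed

text \<open>A point on the boundary of \<open>\<Omega>\<close> need not have neighbours in \<open>\<Omega>\<close> in a prescribed direction \<open>v\<close>, but a
nearby interior point has. This is why base points of difference quotients are moved off \<open>a\<close>.\<close>

lemma nearby_displaced_pair:
  fixes a v :: "'a::real_normed_vector"
  assumes "a \<in> closure (interior \<Omega>)" "0 < \<rho>"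
  obtains b \<epsilon> where "0 < \<epsilon>" "b \<in> \<Omega>" "b + \<epsilon> *\<^sub>R v \<in> \<Omega>"
    "norm (b - a) < \<rho>" "norm (b + \<epsilon> *\<^sub>R v - a) < \<rho>"
proof -
  obtain b where b: "b \<in> interior \<Omega>" "dist b a < \<rho>"
    using assms by (auto simp: closure_approachable)
  let ?S = "interior \<Omega> \<inter> ball a \<rho>"
  have "((\<lambda>s. b + s *\<^sub>R v) \<longlongrightarrow> b + 0 *\<^sub>R v) (at_right 0)"
    by (intro tendsto_intros)
  moreover have "open ?S" "b + 0 *\<^sub>R v \<in> ?S" using b by (auto simp: dist_commute)
  ultimately have "\<forall>\<^sub>F s in at_right 0. b + s *\<^sub>R v \<in> ?S"
    by (rule topological_tendstoD)
  then have "\<forall>\<^sub>F s in at_right 0. b + s *\<^sub>R v \<in> ?S \<and> 0 < s"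
    using eventually_at_right_less by (rule eventually_conj)
  then obtain \<epsilon> :: real where "b + \<epsilon> *\<^sub>R v \<in> ?S" "0 < \<epsilon>"
    using eventually_happens'[OF trivial_limit_at_right_real] by blast
  then show ?thesis
    using that[of \<epsilon> b] b interior_subset[of \<Omega>] by (auto simp: dist_norm norm_minus_commute)
qed

text \<open>For \<open>b\<close> and \<open>c = b + \<epsilon> v\<close> in \<open>\<Omega>\<close> close to \<open>a\<close>, where \<open>v = \<delta>(0)\<close>, the difference
\<open>D = x(t, c) - x(t, b)\<close> is bounded by \<open>\<epsilon> L |v|\<close>. The error \<open>e = D / \<epsilon> - \<delta>\<close> starts at \<open>0\<close> and satisfies
\<open>e' = J e + R\<close> with \<open>J\<close> taken along the trajectory of \<open>a\<close>. By the mean value inequality \<open>R\<close> is at most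
\<open>L |v|\<close> times the oscillation of \<open>J\<close> near that trajectory. On a compact time interval the oscillation
is as small as desired, and so is \<open>e\<close>.\<close>

lemma variational_solution_norm_le:
  fixes f :: "real \<Rightarrow> real^'n \<Rightarrow> real^'n"
  assumes C1: "C1_in_state f" and sol: "solution_map f \<Omega> x"
    and dense: "\<Omega> \<subseteq> closure (interior \<Omega>)"
    and lip: "\<And>a b t. a \<in> \<Omega> \<Longrightarrow> b \<in> \<Omega> \<Longrightarrow> 0 \<le> t \<Longrightarrow> norm (x t a - x t b) \<le> L * norm (a - b)"
    and "0 < L" and a: "a \<in> \<Omega>" and var: "variational_solution f (\<lambda>t. x t a) \<delta>" and T: "0 \<le> T"
  shows "norm (\<delta> T) \<le> L * norm (\<delta> 0)"
proof -
  define J where "J = (\<lambda>t z. jacobian (f t) (at z))"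
  define v where "v = \<delta> 0"
  have within: "(g has_vector_derivative g') (at s within {0..T})"
    if "(g has_vector_derivative g') (at s within {0..})" for g :: "real \<Rightarrow> real^'n" and g' s
    using that by (rule has_vector_derivative_within_subset) auto
  have x': "((\<lambda>t. x t b) has_vector_derivative f s (x s b)) (at s within {0..T})"
    if "b \<in> \<Omega>" "s \<in> {0..T}" for b s
    using sol that unfolding solution_map_def trajectory_def by (intro within) auto
  have \<delta>': "(\<delta> has_vector_derivative J s (x s a) *v \<delta> s) (at s within {0..T})" if "s \<in> {0..T}" for s
    using var that unfolding variational_solution_def J_def by (intro within) auto
  have "continuous_on {0..T} (\<lambda>s. x s a)"
    using x'[OF a] by (rule continuous_on_vector_derivative)
  then obtain R where R: "\<And>s. s \<in> {0..T} \<Longrightarrow> norm (x s a) \<le> R"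
    using continuous_on_compact_norm_bound[OF compact_Icc] by metis
  \<comment> \<open>the extra radius \<open>1\<close> leaves room for the two neighbouring trajectories\<close>
  define C where "C = {0..T} \<times> cball (0 :: real^'n) (R + 1)"
  have "compact C" unfolding C_def by (intro compact_Times) auto
  have contJ: "continuous_on C (\<lambda>(t, z). J t z)"
    using C1 unfolding C1_in_state_def J_def C_def by (auto elim: continuous_on_subset)
  have unif: "uniformly_continuous_on C (\<lambda>(t, z). J t z)"
    using contJ \<open>compact C\<close> by (rule compact_uniformly_continuous)
  obtain K where K: "0 \<le> K" "\<And>s. s \<in> C \<Longrightarrow> norm ((\<lambda>(t, z). J t z) s) \<le> K"
    using continuous_on_compact_norm_bound[OF \<open>compact C\<close> contJ] by metis
  have KJ: "norm (J s (x s a)) \<le> K" if "s \<in> {0..T}" for s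
    using K(2)[of "(s, x s a)"] R[OF that] that unfolding C_def by simp
  \<comment> \<open>the factor by which Gronwall's estimate turns an oscillation \<open>\<omega>\<close> of \<open>J\<close> into an error at time \<open>T\<close>\<close>
  define B where "B = L * norm v * sqrt (T * exp ((2 * K + 1) * T))"
  have B: "0 \<le> B" using \<open>0 < L\<close> T by (simp add: B_def)
  have main: "norm (\<delta> T) \<le> L * norm v + \<omega> * B" if \<omega>: "0 < \<omega>" for \<omega>
  proof -
    obtain \<rho>0 where \<rho>0: "0 < \<rho>0" "\<And>t z t' z'. (t, z) \<in> C \<Longrightarrow> (t', z') \<in> C \<Longrightarrow>
        dist (t', z') (t, z) < \<rho>0 \<Longrightarrow> dist (J t' z') (J t z) < \<omega>"
      using unif \<omega> unfolding uniformly_continuous_on_def by (metis (no_types, lifting) case_prod_conv)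
    define \<rho> where "\<rho> = min 1 \<rho>0"
    have \<rho>: "0 < \<rho>" "\<rho> \<le> 1" "\<rho> \<le> \<rho>0" using \<rho>0(1) by (auto simp: \<rho>_def)
    obtain b \<epsilon> where \<epsilon>: "0 < \<epsilon>" and b: "b \<in> \<Omega>" "b + \<epsilon> *\<^sub>R v \<in> \<Omega>"
      "norm (b - a) < \<rho> / L" "norm (b + \<epsilon> *\<^sub>R v - a) < \<rho> / L"
    proof (rule nearby_displaced_pair)
      show "a \<in> closure (interior \<Omega>)" using a dense by blast
      show "0 < \<rho> / L" using \<rho> \<open>0 < L\<close> by simp
    qed
    define c where "c = b + \<epsilon> *\<^sub>R v"
    define D where "D = (\<lambda>s. x s c - x s b)"
    define e where "e = (\<lambda>s. (1 / \<epsilon>) *\<^sub>R D s - \<delta> s)"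
    define e' where "e' = (\<lambda>s. (1 / \<epsilon>) *\<^sub>R (f s (x s c) - f s (x s b)) - J s (x s a) *v \<delta> s)"
    have c: "c \<in> \<Omega>" "norm (c - a) < \<rho> / L" using b by (auto simp: c_def)
    have D: "norm (D s) \<le> \<epsilon> * (L * norm v)" if "s \<in> {0..T}" for s
      using lip[OF c(1) b(1), of s] that \<epsilon> by (auto simp: D_def c_def mult_ac)
    have near: "norm (x s d - x s a) < \<rho>" if "d \<in> \<Omega>" "norm (d - a) < \<rho> / L" "s \<in> {0..T}" for d s
    proof -
      have "L * norm (d - a) < \<rho>" using that(2) \<open>0 < L\<close> by (simp add: field_simps)
      then show ?thesis using lip[OF that(1) a, of s] that(3) by auto
    qed
    have e_deriv: "(e has_vector_derivative e' s) (at s within {0..T})" if "s \<in> {0..T}" for s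
      unfolding e_def e'_def D_def
      using that
      by (intro has_vector_derivative_diff bounded_linear.has_vector_derivative[OF bounded_linear_scaleR_right]
          x' c b \<delta>')
    have lin: "norm (e' s - J s (x s a) *v e s) \<le> \<omega> * (L * norm v)" if s: "s \<in> {0..T}" for s
    proof -
      have seg: "x s b + t *\<^sub>R (x s c - x s b) \<in> ball (x s a) \<rho>" if "t \<in> {0..1}" for t
      proof -
        have "x s b \<in> ball (x s a) \<rho>" "x s c \<in> ball (x s a) \<rho>"
          using near[OF b(1,3) s] near[OF c s] by (auto simp: dist_norm norm_minus_commute)
        then show ?thesis
          using convexD_alt[OF convex_ball, of "x s b" "x s a" \<rho> "x s c" t] that
          by (simp add: algebra_simps)
      qed
      have "norm (f s (x s c) - f s (x s b) - J s (x s a) *v (x s c - x s b))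
          \<le> norm (x s c - x s b) * \<omega>"
      proof (rule differentiable_bound_linearization[where S = "ball (x s a) \<rho>"
            and f' = "\<lambda>z. (*v) (J s z)"])
        show "(f s has_derivative (*v) (J s z)) (at z within ball (x s a) \<rho>)" for z
          using C1 s unfolding C1_in_state_def J_def
          by (auto simp: jacobian_works[symmetric] intro: has_derivative_at_withinI)
        show "onorm ((*v) (J s z) - (*v) (J s (x s a))) \<le> \<omega>" if z: "z \<in> ball (x s a) \<rho>" for z
        proof (rule onorm_bound)
          fix u :: "real^'n"
          have "norm z \<le> norm (x s a) + norm (z - x s a)"
            using norm_triangle_ineq[of "x s a" "z - x s a"] by simp
          then have "(s, z) \<in> C" "(s, x s a) \<in> C"
            using R[OF s] s z \<rho> by (auto simp: C_def dist_norm norm_minus_commute)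
          then have "dist (J s z) (J s (x s a)) < \<omega>"
            using z \<rho> by (intro \<rho>0(2)) (auto simp: dist_Pair_Pair dist_commute)
          then have "norm (J s z - J s (x s a)) * norm u \<le> \<omega> * norm u"
            by (intro mult_right_mono) (auto simp: dist_norm)
          then show "norm (((*v) (J s z) - (*v) (J s (x s a))) u) \<le> \<omega> * norm u"
            using norm_matrix_vector_mult_le[of "J s z - J s (x s a)" u]
            by (simp add: matrix_vector_mult_diff_rdistrib)
        qed (use \<omega> in auto)
        show "x s a \<in> ball (x s a) \<rho>" using \<rho> by simp
      qed (rule seg)
      also have "\<dots> \<le> \<epsilon> * (L * norm v) * \<omega>"
        using D[OF s] \<omega> by (intro mult_right_mono) (auto simp: D_def)
      finally have *: "norm (f s (x s c) - f s (x s b) - J s (x s a) *v D s) \<le> \<epsilon> * (L * norm v) * \<omega>"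
        by (simp add: D_def)
      have "e' s - J s (x s a) *v e s =
          (1 / \<epsilon>) *\<^sub>R (f s (x s c) - f s (x s b) - J s (x s a) *v D s)"
        by (simp add: e_def e'_def matrix_vector_mult_diff_distrib matrix_vector_mult_scaleR
            scaleR_diff_right)
      then have "norm (e' s - J s (x s a) *v e s) =
          norm (f s (x s c) - f s (x s b) - J s (x s a) *v D s) / \<epsilon>"
        using \<epsilon> by simp
      also have "\<dots> \<le> \<epsilon> * (L * norm v) * \<omega> / \<epsilon>"
        using * \<epsilon> by (intro divide_right_mono) auto
      finally show ?thesis using \<epsilon> by (simp add: mult.commute)
    qed
    let ?d = "\<omega> * (L * norm v)"
    have "inner (e T) (e T) \<le> ?d\<^sup>2 * T * exp ((2 * K + 1) * T)"
    proof (rule gronwall)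
      show "((\<lambda>s. inner (e s) (e s)) has_real_derivative inner (e s) (e' s) + inner (e' s) (e s))
          (at s within {0..T})" if "s \<in> {0..T}" for s
        unfolding has_real_derivative_iff_has_vector_derivative
        by (rule bounded_bilinear.has_vector_derivative[OF bounded_bilinear_inner e_deriv e_deriv, OF that that])
      show "inner (e s) (e' s) + inner (e' s) (e s) \<le> (2 * K + 1) * inner (e s) (e s) + ?d\<^sup>2"
        if s: "s \<in> {0..T}" for s
      proof -
        have "norm (e' s) \<le> norm (J s (x s a) *v e s) + ?d"
          using lin[OF s] norm_triangle_sub[of "e' s" "J s (x s a) *v e s"] by linarith
        also have "norm (J s (x s a) *v e s) \<le> K * norm (e s)"
          using norm_matrix_vector_mult_le KJ[OF s] by (meson mult_right_mono norm_ge_zero order_trans)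
        finally have "inner (e s) (e' s) \<le> norm (e s) * (K * norm (e s) + ?d)"
          using norm_cauchy_schwarz[of "e s" "e' s"] by (smt (verit) mult_left_mono norm_ge_zero)
        moreover have "0 \<le> (norm (e s) - ?d)\<^sup>2" by simp
        ultimately show ?thesis
          by (simp add: inner_commute[of "e' s"] power2_norm_eq_inner[symmetric] power2_eq_square
              algebra_simps)
      qed
      show "inner (e 0) (e 0) = 0"
        using sol b(1) c(1) \<epsilon> unfolding e_def D_def solution_map_def v_def[symmetric] c_def by simp
    qed (use T K in auto)
    then have "(norm (e T))\<^sup>2 \<le> ?d\<^sup>2 * (T * exp ((2 * K + 1) * T))"
      by (simp add: power2_norm_eq_inner mult.assoc)
    then have "norm (e T) \<le> sqrt (?d\<^sup>2 * (T * exp ((2 * K + 1) * T)))"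
      by (rule real_le_rsqrt)
    also have "\<dots> = \<omega> * B"
      using \<omega> \<open>0 < L\<close> by (simp add: real_sqrt_mult B_def)
    finally have eT: "norm (e T) \<le> \<omega> * B" .
    have "\<delta> T = (1 / \<epsilon>) *\<^sub>R D T - e T" by (simp add: e_def)
    then have "norm (\<delta> T) \<le> norm ((1 / \<epsilon>) *\<^sub>R D T) + norm (e T)"
      by (metis norm_triangle_ineq4)
    moreover have "norm ((1 / \<epsilon>) *\<^sub>R D T) \<le> L * norm v"
      using D[of T] T \<epsilon> by (simp add: field_simps)
    ultimately show ?thesis using eT by linarith
  qed
  show ?thesis
    unfolding v_def[symmetric]
  proof (rule field_le_epsilon)
    fix r :: real assume "0 < r"
    then have "norm (\<delta> T) \<le> L * norm v + r / (B + 1) * B"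
      using B by (intro main) auto
    also have "r / (B + 1) * B \<le> r"
      using B \<open>0 < r\<close> by (simp add: field_simps)
    finally show "norm (\<delta> T) \<le> L * norm v + r" by simp
  qed
qed

section \<open>Cauchy-Binet formula and multiplicative compounds\<close>

lemma bij_betw_pick: "finite S \<Longrightarrow> bij_betw (pick S) {0..<card S} S"
proof -
  assume "finite S"
  have inj: "inj_on (pick S) {0..<card S}"
    by (intro linorder_inj_onI') (auto dest: pick_mono_le[of _ S])
  moreover have "pick S ` {0..<card S} \<subseteq> S"
    by (auto intro: pick_in_set_le)
  ultimately show "bij_betw (pick S) {0..<card S} S"
    using \<open>finite S\<close> inj card_subset_eq[of S "pick S ` {0..<card S}"]
    by (simp add: bij_betw_def card_image)
qed

text \<open>In the proof of the Cauchy-Binet formula this discards the selections that repeat a row.\<close>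

lemma det_row_selection_not_inj:
  fixes B :: "nat \<Rightarrow> nat \<Rightarrow> 'a::comm_ring_1"
  assumes "\<not> inj_on g {0..<k}"
  shows "Determinant.det (Matrix.mat k k (\<lambda>(i, j). B (g i) j)) = 0"
proof -
  obtain i j where "i < k" "j < k" "i \<noteq> j" "g i = g j"
    using assms by (auto simp: inj_on_def)
  then show ?thesis
    by (intro det_identical_rows[of _ k i j]) (auto intro!: eq_vecI)
qed

text \<open>Expanding the product matrix by multilinearity in its rows gives a sum over all maps \<open>g\<close> that select
a row of \<open>B\<close> for every row of \<open>A\<close>. Only injective maps contribute. Those with image \<open>S\<close> are the
increasing enumeration \<open>pick S\<close> composed with a permutation \<open>p\<close>; sorting the rows of \<open>B\<close> yields the sign
of \<open>p\<close>, and summing over \<open>p\<close> reassembles the determinant of the columns \<open>S\<close> of \<open>A\<close>.\<close>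

theorem Cauchy_Binet:
  fixes A B :: "'a::comm_ring_1 Matrix.mat"
  assumes A: "A \<in> carrier_mat k n" and B: "B \<in> carrier_mat n k"
  shows "Determinant.det (A * B) = (\<Sum>S | S \<subseteq> {0..<n} \<and> card S = k.
    Determinant.det (Matrix.mat k k (\<lambda>(i, j). A $$ (i, pick S j))) *
    Determinant.det (Matrix.mat k k (\<lambda>(i, j). B $$ (pick S i, j))))"
proof -
  let ?K = "{0..<k}" and ?P = "{p. p permutes {0..<k}}"
  let ?F = "{0..<k} \<rightarrow>\<^sub>E {0..<n}"
  let ?T = "{S. S \<subseteq> {0..<n} \<and> card S = k}"
  let ?rows = "\<lambda>g. Matrix.mat k k (\<lambda>(i, j). B $$ (g i, j))"
  let ?cols = "\<lambda>g. Matrix.mat k k (\<lambda>(i, j). A $$ (i, g j))"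
  let ?term = "\<lambda>g. (\<Prod>i = 0..<k. A $$ (i, g i)) * Determinant.det (?rows g)"
  have fin: "finite ?F" by (intro finite_PiE) auto
  have "Determinant.det (A * B) = (\<Sum>p\<in>?P. signof p * (\<Prod>i = 0..<k. (A * B) $$ (i, p i)))"
    using A B by (intro det_def') simp
  also have "\<dots> = (\<Sum>p\<in>?P. signof p * (\<Prod>i = 0..<k. \<Sum>l\<in>{0..<n}. A $$ (i, l) * B $$ (l, p i)))"
    using A B permutes_in_image
    by (intro sum.cong prod.cong refl arg_cong2[where f = "(*)"])
      (fastforce simp: scalar_prod_def permutes_in_image intro!: sum.cong)
  also have "\<dots> = (\<Sum>p\<in>?P. \<Sum>g\<in>?F. signof p * (\<Prod>i = 0..<k. A $$ (i, g i) * B $$ (g i, p i)))"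
    by (subst prod_sum_PiE) (simp_all add: sum_distrib_left)
  also have "\<dots> = (\<Sum>g\<in>?F. \<Sum>p\<in>?P. signof p * (\<Prod>i = 0..<k. A $$ (i, g i) * B $$ (g i, p i)))"
    by (rule sum.swap)
  also have "\<dots> = (\<Sum>g\<in>?F. ?term g)"
  proof (intro sum.cong refl)
    fix g assume "g \<in> ?F"
    have "Determinant.det (?rows g) = (\<Sum>p\<in>?P. signof p * (\<Prod>i = 0..<k. B $$ (g i, p i)))"
      by (subst det_def'[of _ k]) (auto simp: permutes_in_image intro!: sum.cong prod.cong arg_cong2[where f = "(*)"])
    then show "(\<Sum>p\<in>?P. signof p * (\<Prod>i = 0..<k. A $$ (i, g i) * B $$ (g i, p i))) = ?term g"
      by (simp add: prod.distrib sum_distrib_left mult_ac)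
  qed
  also have "\<dots> = (\<Sum>g | g \<in> ?F \<and> inj_on g ?K. ?term g)"
    using fin by (intro sum.mono_neutral_right) (auto simp: det_row_selection_not_inj[where B = "\<lambda>i j. B $$ (i, j)"])
  also have "\<dots> = (\<Sum>S\<in>?T. \<Sum>g | g \<in> {g. g \<in> ?F \<and> inj_on g ?K} \<and> g ` ?K = S. ?term g)"
    by (intro sum.group[symmetric]) (auto intro: finite_subset[OF _ fin] simp: card_image)
  also have "\<dots> = (\<Sum>S\<in>?T. Determinant.det (?cols (pick S)) * Determinant.det (?rows (pick S)))"
  proof (intro sum.cong refl)
    fix S assume S: "S \<in> ?T"
    then have "finite S" using finite_subset by auto
    then have pick: "bij_betw (pick S) ?K S" using bij_betw_pick[of S] S by simp
    \<comment> \<open>the position of an element of \<open>S\<close> in increasing order; it turns a selection into a permutation\<close>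
    let ?rank = "inv_into ?K (pick S)"
    have rank: "bij_betw ?rank S ?K" by (rule bij_betw_inv_into[OF pick])
    have "(\<Sum>g | g \<in> {g. g \<in> ?F \<and> inj_on g ?K} \<and> g ` ?K = S. ?term g)
      = (\<Sum>p\<in>?P. (\<Prod>i = 0..<k. A $$ (i, pick S (p i))) * (signof p * Determinant.det (?rows (pick S))))"
    proof (rule sum.reindex_bij_witness
        [where i = "\<lambda>p. restrict (\<lambda>i. pick S (p i)) ?K" and j = "\<lambda>g i. if i \<in> ?K then ?rank (g i) else i"])
      fix g assume g: "g \<in> {g. g \<in> {g. g \<in> ?F \<and> inj_on g ?K} \<and> g ` ?K = S}"
      let ?p = "\<lambda>i. if i \<in> ?K then ?rank (g i) else i"
      have p_back: "pick S (?p i) = g i" if "i < k" for i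
        using that g bij_betw_inv_into_right[OF pick] by auto
      show "restrict (\<lambda>i. pick S (?p i)) ?K = g"
        using g p_back by (intro ext) (auto simp: PiE_def extensional_def restrict_def)
      have "bij_betw (?rank \<circ> g) ?K ?K"
        using g by (intro bij_betw_trans[OF _ rank]) (auto simp: bij_betw_def)
      then have "bij_betw ?p ?K ?K" by (rule bij_betw_cong[THEN iffD1, rotated]) auto
      then have p: "?p permutes ?K" by (rule bij_imp_permutes) auto
      then show "?p \<in> ?P" by simp
      have "?p i < k" if "i < k" for i
        using permutes_in_image[OF p, of i] that by (simp only: atLeastLessThan_iff zero_le simp_thms)
      then have "?rows g = Matrix.mat k k (\<lambda>(i, j). ?rows (pick S) $$ (?p i, j))"
        using p_back by (intro eq_matI) simp_all
      then have "Determinant.det (?rows g) = signof ?p * Determinant.det (?rows (pick S))"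
        using det_permute_rows[OF _ p, of "?rows (pick S)"] by simp
      moreover have "(\<Prod>i = 0..<k. A $$ (i, g i)) = (\<Prod>i = 0..<k. A $$ (i, pick S (?p i)))"
        by (intro prod.cong refl) (use p_back in auto)
      ultimately show "(\<Prod>i = 0..<k. A $$ (i, pick S (?p i))) * (signof ?p * Determinant.det (?rows (pick S)))
          = ?term g" by simp
    next
      fix p assume "p \<in> ?P"
      then have p: "p permutes ?K" by simp
      let ?g = "restrict (\<lambda>i. pick S (p i)) ?K"
      show "(\<lambda>i. if i \<in> ?K then ?rank (?g i) else i) = p"
        using permutes_in_image[OF p] permutes_not_in[OF p] bij_betw_inv_into_left[OF pick]
        by (intro ext) auto
      have "bij_betw (pick S \<circ> p) ?K S"
        using permutes_imp_bij[OF p] pick by (rule bij_betw_trans)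
      then have "bij_betw ?g ?K S" by (rule bij_betw_cong[THEN iffD1, rotated]) auto
      then show "?g \<in> {g. g \<in> {g. g \<in> ?F \<and> inj_on g ?K} \<and> g ` ?K = S}"
        using S by (auto simp: bij_betw_def)
    qed
    also have "\<dots> = (\<Sum>p\<in>?P. signof p * (\<Prod>i = 0..<k. ?cols (pick S) $$ (i, p i))) * Determinant.det (?rows (pick S))"
      unfolding sum_distrib_right
      by (intro sum.cong refl) (auto simp: permutes_in_image mult_ac intro!: prod.cong arg_cong2[where f = "(*)"])
    also have "\<dots> = Determinant.det (?cols (pick S)) * Determinant.det (?rows (pick S))"
      by (subst det_def'[of "?cols (pick S)" k]) auto
    finally show "(\<Sum>g | g \<in> {g. g \<in> ?F \<and> inj_on g ?K} \<and> g ` ?K = S. ?term g)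
      = Determinant.det (?cols (pick S)) * Determinant.det (?rows (pick S))" .
  qed
  finally show ?thesis .
qed

lemma
  shows distinct_lex_subsets: "distinct (lex_subsets n k)"
    and set_lex_subsets: "set (lex_subsets n k) = {S. S \<subseteq> {0..<n} \<and> card S = k}"
    and length_lex_subsets: "length (lex_subsets n k) = n choose k"
proof -
  show d: "distinct (lex_subsets n k)"
    unfolding lex_subsets_def by (intro distinct_map_filter distinct_set_subseqs distinct_upt)
  have "card (set xs) = length xs" if "xs \<in> set (subseqs [0..<n])" for xs
    using subseqs_distinctD[OF that] by (simp add: distinct_card)
  then have "set (lex_subsets n k) = {S \<in> set ` set (subseqs [0..<n]). card S = k}"
    by (auto simp: lex_subsets_def)
  then show s: "set (lex_subsets n k) = {S. S \<subseteq> {0..<n} \<and> card S = k}"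
    by (auto simp: subseqs_powset)
  show "length (lex_subsets n k) = n choose k"
    using distinct_card[OF d] n_subsets[of "{0..<n}" k] by (simp add: s)
qed

lemma lex_subsets_nth:
  assumes "i < n choose k"
  shows "lex_subsets n k ! i \<subseteq> {0..<n}" "card (lex_subsets n k ! i) = k"
  using assms nth_mem[of i "lex_subsets n k"] by (auto simp: length_lex_subsets set_lex_subsets)

lemma pick_lex_subsets_less:
  assumes "i < n choose k" "r < k"
  shows "pick (lex_subsets n k ! i) r < n"
  using assms lex_subsets_nth[of i n k] pick_in_set_le[of r "lex_subsets n k ! i"] by auto

lemma carrier_mult_compound [simp]:
  "A \<in> carrier_mat a b \<Longrightarrow> mult_compound k A \<in> carrier_mat (a choose k) (b choose k)"
  by (simp add: mult_compound_def)

lemma carrier_add_compound [simp]: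
  "A \<in> carrier_mat a b \<Longrightarrow> add_compound k A \<in> carrier_mat (a choose k) (a choose k)"
  by (simp add: add_compound_def)

text \<open>The submatrix underlying an entry of the multiplicative compound, with its dimensions made
explicit. Unlike \<open>submatrix\<close> it is always \<open>k \<times> k\<close>, whatever the indices.\<close>

definition minor_mat :: "nat \<Rightarrow> real Matrix.mat \<Rightarrow> nat \<Rightarrow> nat \<Rightarrow> real Matrix.mat"
  where "minor_mat k A i j = Matrix.mat k k
    (\<lambda>(r, c). A $$ (pick (lex_subsets (dim_row A) k ! i) r, pick (lex_subsets (dim_col A) k ! j) c))"

lemma carrier_minor_mat [simp]: "minor_mat k A i j \<in> carrier_mat k k"
  by (simp add: minor_mat_def)

lemma mult_compound_index:
  assumes A: "A \<in> carrier_mat a b" and i: "i < a choose k" and j: "j < b choose k"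
  shows "mult_compound k A $$ (i, j) = Determinant.det (minor_mat k A i j)"
proof -
  have "{r. r < n \<and> r \<in> lex_subsets n k ! i} = lex_subsets n k ! i" if "i < n choose k" for n i
    using lex_subsets_nth(1)[OF that] by auto
  then have "submatrix A (lex_subsets a k ! i) (lex_subsets b k ! j) = minor_mat k A i j"
    using A i j by (simp add: submatrix_def minor_mat_def lex_subsets_nth(2))
  then show ?thesis
    using assms by (simp add: mult_compound_def)
qed

theorem mult_compound_mult:
  assumes A: "A \<in> carrier_mat a n" and B: "B \<in> carrier_mat n b"
  shows "mult_compound k (A * B) = mult_compound k A * mult_compound k B"
proof (rule eq_matI)
  fix i j assume "i < dim_row (mult_compound k A * mult_compound k B)"
    and "j < dim_col (mult_compound k A * mult_compound k B)"
  then have i: "i < a choose k" and j: "j < b choose k"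
    using A B by (auto simp: mult_compound_def)
  define AI where "AI = Matrix.mat k n (\<lambda>(r, c). A $$ (pick (lex_subsets a k ! i) r, c))"
  define BJ where "BJ = Matrix.mat n k (\<lambda>(r, c). B $$ (r, pick (lex_subsets b k ! j) c))"
  have carr: "AI \<in> carrier_mat k n" "BJ \<in> carrier_mat n k"
    by (simp_all add: AI_def BJ_def)
  have "minor_mat k (A * B) i j = AI * BJ"
    using A B pick_lex_subsets_less[OF i] pick_lex_subsets_less[OF j]
    by (intro eq_matI) (auto simp: minor_mat_def AI_def BJ_def scalar_prod_def intro!: sum.cong)
  then have "mult_compound k (A * B) $$ (i, j) = Determinant.det (AI * BJ)"
    using mult_compound_index[OF mult_carrier_mat[OF A B] i j] by simp
  also have "\<dots> = (\<Sum>S\<in>set (lex_subsets n k).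
      Determinant.det (Matrix.mat k k (\<lambda>(i, j). AI $$ (i, pick S j))) *
      Determinant.det (Matrix.mat k k (\<lambda>(i, j). BJ $$ (pick S i, j))))"
    by (simp add: Cauchy_Binet[OF carr] set_lex_subsets)
  also have "\<dots> = (\<Sum>l\<in>{..<n choose k}.
      Determinant.det (Matrix.mat k k (\<lambda>(i, j). AI $$ (i, pick (lex_subsets n k ! l) j))) *
      Determinant.det (Matrix.mat k k (\<lambda>(i, j). BJ $$ (pick (lex_subsets n k ! l) i, j))))"
    by (intro sum.reindex_bij_betw[symmetric] bij_betw_nth distinct_lex_subsets)
      (simp_all add: length_lex_subsets)
  also have "\<dots> = (\<Sum>l\<in>{..<n choose k}. mult_compound k A $$ (i, l) * mult_compound k B $$ (l, j))"
  proof (intro sum.cong refl arg_cong2[where f = "(*)"])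
    fix l assume "l \<in> {..<n choose k}"
    then have l: "l < n choose k" by simp
    have "Matrix.mat k k (\<lambda>(i, j). AI $$ (i, pick (lex_subsets n k ! l) j)) = minor_mat k A i l"
      using A pick_lex_subsets_less[OF l] by (intro eq_matI) (auto simp: AI_def minor_mat_def)
    then show "Determinant.det (Matrix.mat k k (\<lambda>(i, j). AI $$ (i, pick (lex_subsets n k ! l) j)))
        = mult_compound k A $$ (i, l)"
      using mult_compound_index[OF A i l] by simp
    have "Matrix.mat k k (\<lambda>(i, j). BJ $$ (pick (lex_subsets n k ! l) i, j)) = minor_mat k B l j"
      using B pick_lex_subsets_less[OF l] by (intro eq_matI) (auto simp: BJ_def minor_mat_def)
    then show "Determinant.det (Matrix.mat k k (\<lambda>(i, j). BJ $$ (pick (lex_subsets n k ! l) i, j)))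
        = mult_compound k B $$ (l, j)"
      using mult_compound_index[OF B l j] by simp
  qed
  also have "\<dots> = (mult_compound k A * mult_compound k B) $$ (i, j)"
    using A B i j by (auto simp: scalar_prod_def mult_compound_def lessThan_atLeast0 intro!: sum.cong)
  finally show "mult_compound k (A * B) $$ (i, j) = (mult_compound k A * mult_compound k B) $$ (i, j)" .
qed (use A B in \<open>simp_all add: mult_compound_def\<close>)

section \<open>Derivatives of compounds\<close>

lemma minor_mat_index:
  assumes "A \<in> carrier_mat a b" "r < k" "c < k"
  shows "minor_mat k A i j $$ (r, c) = A $$ (pick (lex_subsets a k ! i) r, pick (lex_subsets b k ! j) c)"
  using assms by (simp add: minor_mat_def)

text \<open>The differential of the determinant at \<open>A\<close> in the direction \<open>D\<close>: Leibniz' formula differentiated by the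
product rule. In this polynomial form it is visibly continuous in \<open>A\<close> and \<open>D\<close>.\<close>

definition det_differential :: "real Matrix.mat \<Rightarrow> real Matrix.mat \<Rightarrow> real"
  where "det_differential A D = (\<Sum>p | p permutes {0..<dim_row A}. signof p *
    (\<Sum>i = 0..<dim_row A. D $$ (i, p i) * (\<Prod>j\<in>{0..<dim_row A} - {i}. A $$ (j, p j))))"

lemma has_real_derivative_det:
  assumes carr: "\<And>s. X s \<in> carrier_mat k k"
    and deriv: "\<And>i j. i < k \<Longrightarrow> j < k \<Longrightarrow>
      ((\<lambda>s. X s $$ (i, j)) has_real_derivative D $$ (i, j)) (at t within S)"
  shows "((\<lambda>s. Determinant.det (X s)) has_real_derivative det_differential (X t) D) (at t within S)"
proof -
  have "((\<lambda>s. \<Prod>i = 0..<k. X s $$ (i, p i)) has_real_derivative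
      (\<Sum>i = 0..<k. D $$ (i, p i) * (\<Prod>j\<in>{0..<k} - {i}. X t $$ (j, p j)))) (at t within S)"
    if p: "p permutes {0..<k}" for p
  proof -
    have "((\<lambda>s. \<Prod>i = 0..<k. X s $$ (i, p i)) has_derivative
        (\<lambda>h. \<Sum>i = 0..<k. D $$ (i, p i) * h * (\<Prod>j\<in>{0..<k} - {i}. X t $$ (j, p j)))) (at t within S)"
      using deriv permutes_in_image[OF p]
      by (intro has_derivative_prod) (simp add: has_field_derivative_def)
    then show ?thesis
      unfolding has_field_derivative_def
      by (rule has_derivative_eq_rhs) (simp add: fun_eq_iff sum_distrib_left sum_distrib_right mult_ac)
  qed
  then have "((\<lambda>s. \<Sum>p | p permutes {0..<k}. signof p * (\<Prod>i = 0..<k. X s $$ (i, p i)))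
      has_real_derivative (\<Sum>p | p permutes {0..<k}. signof p *
        (\<Sum>i = 0..<k. D $$ (i, p i) * (\<Prod>j\<in>{0..<k} - {i}. X t $$ (j, p j))))) (at t within S)"
    by (intro DERIV_sum DERIV_cmult) simp
  then show ?thesis
    using carr[of t] by (simp add: det_differential_def det_def'[OF carr])
qed

lemma has_real_derivative_mult_compound:
  assumes carr: "\<And>s. X s \<in> carrier_mat a b" "D \<in> carrier_mat a b"
    and deriv: "\<And>r c. r < a \<Longrightarrow> c < b \<Longrightarrow>
      ((\<lambda>s. X s $$ (r, c)) has_real_derivative D $$ (r, c)) (at t within S)"
    and i: "i < a choose k" and j: "j < b choose k"
  shows "((\<lambda>s. mult_compound k (X s) $$ (i, j)) has_real_derivative
    det_differential (minor_mat k (X t) i j) (minor_mat k D i j)) (at t within S)"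
  unfolding mult_compound_index[OF carr(1) i j]
proof (rule has_real_derivative_det)
  fix r c assume "r < k" "c < k"
  then show "((\<lambda>s. minor_mat k (X s) i j $$ (r, c)) has_real_derivative minor_mat k D i j $$ (r, c))
      (at t within S)"
    by (simp add: minor_mat_index[OF carr(1)] minor_mat_index[OF carr(2)]
        deriv pick_lex_subsets_less[OF i] pick_lex_subsets_less[OF j])
qed simp

lemma mult_compound_one_plus_has_derivative:
  assumes A: "A \<in> carrier_mat n n" and i: "i < n choose k" and j: "j < n choose k"
  shows "((\<lambda>\<epsilon>. mult_compound k (1\<^sub>m n + \<epsilon> \<cdot>\<^sub>m A) $$ (i, j)) has_real_derivative
    det_differential (minor_mat k (1\<^sub>m n) i j) (minor_mat k A i j)) (at 0)"
proof -
  have "((\<lambda>\<epsilon>. mult_compound k (1\<^sub>m n + \<epsilon> \<cdot>\<^sub>m A) $$ (i, j)) has_real_derivative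
      det_differential (minor_mat k (1\<^sub>m n + 0 \<cdot>\<^sub>m A) i j) (minor_mat k A i j)) (at 0)"
    using A by (intro has_real_derivative_mult_compound[OF _ A _ i j])
      (auto intro!: derivative_eq_intros)
  moreover have "1\<^sub>m n + 0 \<cdot>\<^sub>m A = 1\<^sub>m n" using A by (intro eq_matI) auto
  ultimately show ?thesis by simp
qed

lemma add_compound_index:
  assumes A: "A \<in> carrier_mat n n" and i: "i < n choose k" and j: "j < n choose k"
  shows "add_compound k A $$ (i, j) = det_differential (minor_mat k (1\<^sub>m n) i j) (minor_mat k A i j)"
  using DERIV_imp_deriv[OF mult_compound_one_plus_has_derivative[OF assms]] A i j
  by (simp add: add_compound_def)

text \<open>If \<open>B\<close> moves with velocity \<open>A B\<close>, its compound moves with velocity \<open>A\<^bsup>[k]\<^esup> B\<^bsup>(k)\<^esup>\<close>: both sides are the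
derivative at \<open>\<epsilon> = 0\<close> of the compound of \<open>B + \<epsilon> A B = (I + \<epsilon> A) B\<close>, which factors by multiplicativity.\<close>

lemma minor_differential_eq_add_compound_mult:
  assumes A: "A \<in> carrier_mat n n" and B: "B \<in> carrier_mat n b"
    and i: "i < n choose k" and j: "j < b choose k"
  shows "det_differential (minor_mat k B i j) (minor_mat k (A * B) i j)
    = (add_compound k A * mult_compound k B) $$ (i, j)"
proof -
  let ?X = "\<lambda>\<epsilon>::real. B + \<epsilon> \<cdot>\<^sub>m (A * B)"
  have carr: "?X \<epsilon> \<in> carrier_mat n b" "1\<^sub>m n + \<epsilon> \<cdot>\<^sub>m A \<in> carrier_mat n n" for \<epsilon> using A B by auto
  have X: "?X \<epsilon> = (1\<^sub>m n + \<epsilon> \<cdot>\<^sub>m A) * B" for \<epsilon>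
    using A B by (simp add: add_mult_distrib_mat[of _ n n] mult_smult_assoc_mat[of _ n n])
  have "((\<lambda>\<epsilon>. mult_compound k (?X \<epsilon>) $$ (i, j)) has_real_derivative
      det_differential (minor_mat k (?X 0) i j) (minor_mat k (A * B) i j)) (at 0)"
    using A B by (intro has_real_derivative_mult_compound[OF carr(1) _ _ i j])
      (auto intro!: derivative_eq_intros)
  moreover have "?X 0 = B" using A B by (intro eq_matI) auto
  ultimately have d1: "((\<lambda>\<epsilon>. mult_compound k (?X \<epsilon>) $$ (i, j)) has_real_derivative
      det_differential (minor_mat k B i j) (minor_mat k (A * B) i j)) (at 0)" by simp
  have "((\<lambda>\<epsilon>. mult_compound k (1\<^sub>m n + \<epsilon> \<cdot>\<^sub>m A) $$ (i, l)) has_real_derivative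
      add_compound k A $$ (i, l)) (at 0)" if "l < n choose k" for l
    using mult_compound_one_plus_has_derivative[OF A i that] add_compound_index[OF A i that] by simp
  then have "((\<lambda>\<epsilon>. \<Sum>l = 0..<n choose k.
        mult_compound k (1\<^sub>m n + \<epsilon> \<cdot>\<^sub>m A) $$ (i, l) * mult_compound k B $$ (l, j)) has_real_derivative
      (\<Sum>l = 0..<n choose k. add_compound k A $$ (i, l) * mult_compound k B $$ (l, j))) (at 0)"
    by (intro DERIV_sum DERIV_cmult_right) simp
  moreover have "mult_compound k (?X \<epsilon>) $$ (i, j) = (\<Sum>l = 0..<n choose k.
      mult_compound k (1\<^sub>m n + \<epsilon> \<cdot>\<^sub>m A) $$ (i, l) * mult_compound k B $$ (l, j))" for \<epsilon>
    unfolding X mult_compound_mult[OF carr(2) B]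
    using A B i j by (auto simp: scalar_prod_def mult_compound_def intro!: sum.cong)
  moreover have "(add_compound k A * mult_compound k B) $$ (i, j) =
      (\<Sum>l = 0..<n choose k. add_compound k A $$ (i, l) * mult_compound k B $$ (l, j))"
    using A B i j by (auto simp: scalar_prod_def mult_compound_def add_compound_def intro!: sum.cong)
  ultimately show ?thesis using DERIV_unique[OF d1] by simp
qed

lemma continuous_on_add_compound:
  assumes carr: "\<And>t. A t \<in> carrier_mat n n"
    and cont: "\<And>r c. r < n \<Longrightarrow> c < n \<Longrightarrow> continuous_on S (\<lambda>t. A t $$ (r, c))"
    and i: "i < n choose k" and j: "j < n choose k"
  shows "continuous_on S (\<lambda>t. add_compound k (A t) $$ (i, j))"
proof -
  have "continuous_on S (\<lambda>t. minor_mat k (A t) i j $$ (r, p r))" if "p permutes {0..<k}" "r < k" for p r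
    using that permutes_in_image[OF that(1), of r] carr
    by (simp add: minor_mat_index[OF carr] cont pick_lex_subsets_less[OF i] pick_lex_subsets_less[OF j])
  then show ?thesis
    unfolding add_compound_index[OF carr i j] det_differential_def
    by (intro continuous_intros) (auto simp: minor_mat_def)
qed

section \<open>Solutions of the compound system\<close>

text \<open>Gronwall's estimate for the squared length. The coefficient functions are indexed by natural numbers
since the size \<open>n choose k\<close> of the compound system is not the cardinality of a given type.\<close>

lemma linear_system_zero:
  fixes u :: "real \<Rightarrow> nat \<Rightarrow> real" and a :: "real \<Rightarrow> nat \<Rightarrow> nat \<Rightarrow> real"
  assumes deriv: "\<And>t i. 0 \<le> t \<Longrightarrow> i < r \<Longrightarrow>
      ((\<lambda>s. u s i) has_real_derivative (\<Sum>j<r. a t i j * u t j)) (at t within {0..})"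
    and cont: "\<And>i j. i < r \<Longrightarrow> j < r \<Longrightarrow> continuous_on {0..} (\<lambda>t. a t i j)"
    and zero: "\<And>i. i < r \<Longrightarrow> u 0 i = 0"
    and T: "0 \<le> T" and i: "i < r"
  shows "u T i = 0"
proof -
  have "continuous_on {0..T} (\<lambda>t. \<Sum>i<r. \<Sum>j<r. \<bar>a t i j\<bar>)"
    by (intro continuous_intros continuous_on_subset[OF cont]) auto
  then obtain K where K: "0 \<le> K" "\<And>t. t \<in> {0..T} \<Longrightarrow> norm (\<Sum>i<r. \<Sum>j<r. \<bar>a t i j\<bar>) \<le> K"
    by (rule continuous_on_compact_norm_bound[OF compact_Icc]) blast
  have aK: "\<bar>a t i j\<bar> \<le> K" if "t \<in> {0..T}" "i < r" "j < r" for t i j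
  proof -
    have "\<bar>a t i j\<bar> \<le> (\<Sum>j<r. \<bar>a t i j\<bar>)"
      using that by (intro member_le_sum[of j]) auto
    also have "\<dots> \<le> (\<Sum>i<r. \<Sum>j<r. \<bar>a t i j\<bar>)"
      using that by (intro member_le_sum[of i "{..<r}" "\<lambda>i. \<Sum>j<r. \<bar>a t i j\<bar>"]) (auto intro: sum_nonneg)
    finally show ?thesis using K(2)[OF that(1)] by simp
  qed
  define E where "E = (\<lambda>t. \<Sum>i<r. (u t i)\<^sup>2)"
  have "E T \<le> 0 * T * exp (2 * r * K * T)"
  proof (rule gronwall)
    fix t assume t: "t \<in> {0..T}"
    show "(E has_real_derivative (\<Sum>i<r. 2 * u t i * (\<Sum>j<r. a t i j * u t j))) (at t within {0..T})"
      unfolding E_def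
    proof (rule DERIV_sum)
      fix i assume "i \<in> {..<r}"
      then have "((\<lambda>s. u s i) has_real_derivative (\<Sum>j<r. a t i j * u t j)) (at t within {0..T})"
        using t by (intro DERIV_subset[OF deriv]) auto
      then show "((\<lambda>s. (u s i)\<^sup>2) has_real_derivative 2 * u t i * (\<Sum>j<r. a t i j * u t j))
          (at t within {0..T})"
        by (auto intro!: derivative_eq_intros)
    qed
    have "(\<Sum>i<r. 2 * u t i * (\<Sum>j<r. a t i j * u t j))
        \<le> (\<Sum>i<r. \<Sum>j<r. K * ((u t i)\<^sup>2 + (u t j)\<^sup>2))"
      unfolding sum_distrib_left
    proof (intro sum_mono)
      fix i j assume ij: "i \<in> {..<r}" "j \<in> {..<r}"
      have "2 * u t i * (a t i j * u t j) \<le> \<bar>a t i j\<bar> * (2 * (\<bar>u t i\<bar> * \<bar>u t j\<bar>))"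
        using abs_ge_self[of "2 * u t i * (a t i j * u t j)"] by (simp add: abs_mult mult_ac)
      also have "\<dots> \<le> K * ((u t i)\<^sup>2 + (u t j)\<^sup>2)"
        using aK[OF t] ij K(1) sum_squares_bound[of "\<bar>u t i\<bar>" "\<bar>u t j\<bar>"]
        by (intro mult_mono) auto
      finally show "2 * u t i * (a t i j * u t j) \<le> K * ((u t i)\<^sup>2 + (u t j)\<^sup>2)" .
    qed
    also have "\<dots> = 2 * r * K * E t + 0"
      by (simp add: E_def sum.distrib distrib_left flip: sum_distrib_left)
    finally show "(\<Sum>i<r. 2 * u t i * (\<Sum>j<r. a t i j * u t j)) \<le> 2 * r * K * E t + 0" .
  qed (use zero T K(1) in \<open>auto simp: E_def\<close>)
  then have "E T = 0"
    using sum_nonneg[of "{..<r}" "\<lambda>i. (u T i)\<^sup>2"] by (simp add: E_def)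
  then show ?thesis
    using i by (simp add: E_def sum_nonneg_eq_0_iff)
qed

text \<open>Minors of the identity with different row and column sets vanish because some selected row has its
only nonzero entry in a column that is not selected.\<close>

lemma mult_compound_one: "mult_compound k (1\<^sub>m n) = 1\<^sub>m (n choose k)"
proof (rule eq_matI)
  fix i j assume "i < dim_row (1\<^sub>m (n choose k) :: real Matrix.mat)" "j < dim_col (1\<^sub>m (n choose k) :: real Matrix.mat)"
  then have i: "i < n choose k" and j: "j < n choose k" by simp_all
  let ?I = "lex_subsets n k ! i" and ?J = "lex_subsets n k ! j"
  have fin: "finite ?I" "finite ?J"
    using lex_subsets_nth(1)[OF i] lex_subsets_nth(1)[OF j] finite_subset by auto
  have pI: "bij_betw (pick ?I) {0..<k} ?I" and pJ: "bij_betw (pick ?J) {0..<k} ?J"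
    using bij_betw_pick[OF fin(1)] bij_betw_pick[OF fin(2)] lex_subsets_nth(2)[OF i] lex_subsets_nth(2)[OF j]
    by simp_all
  have minor: "minor_mat k (1\<^sub>m n) i j =
      Matrix.mat k k (\<lambda>(r, c). if pick ?I r = pick ?J c then 1 else 0)"
    using pick_lex_subsets_less[OF i] pick_lex_subsets_less[OF j]
    by (intro eq_matI) (auto simp: minor_mat_def)
  have "Determinant.det (minor_mat k (1\<^sub>m n) i j) = (if i = j then 1 else 0)"
  proof (cases "i = j")
    case True
    have "minor_mat k (1\<^sub>m n) i j = 1\<^sub>m k"
      unfolding minor using True bij_betw_imp_inj_on[OF pJ]
      by (intro eq_matI) (auto simp: inj_on_eq_iff)
    then show ?thesis using True by simp
  next
    case False
    then have "?I \<noteq> ?J"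
      using i j nth_eq_iff_index_eq[OF distinct_lex_subsets] by (auto simp: length_lex_subsets)
    then have "\<not> ?I \<subseteq> ?J"
      using card_subset_eq[OF fin(2)] lex_subsets_nth(2)[OF i] lex_subsets_nth(2)[OF j] by auto
    then obtain s where s: "s \<in> ?I" "s \<notin> ?J" by blast
    then have "s \<in> pick ?I ` {0..<k}" using bij_betw_imp_surj_on[OF pI] by simp
    then obtain r where r: "r < k" "pick ?I r \<notin> ?J" using s(2) by auto
    have "(\<Prod>m = 0..<k. minor_mat k (1\<^sub>m n) i j $$ (m, p m)) = 0" if p: "p permutes {0..<k}" for p
    proof (rule prod_zero)
      have "p r < k" using permutes_in_image[OF p, of r] r by simp
      then have "pick ?J (p r) \<in> ?J" using bij_betw_imp_surj_on[OF pJ] by auto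
      then have "minor_mat k (1\<^sub>m n) i j $$ (r, p r) = 0"
        using r \<open>p r < k\<close> by (auto simp: minor)
      then show "\<exists>m\<in>{0..<k}. minor_mat k (1\<^sub>m n) i j $$ (m, p m) = 0" using r by auto
    qed simp
    then have "Determinant.det (minor_mat k (1\<^sub>m n) i j) = 0"
      unfolding det_def'[OF carrier_minor_mat]
      by (intro sum.neutral ballI) (simp only: mem_Collect_eq mult_zero_right)
    then show ?thesis using False by simp
  qed
  then show "mult_compound k (1\<^sub>m n) $$ (i, j) = 1\<^sub>m (n choose k) $$ (i, j)"
    using i j by (simp add: mult_compound_index[OF one_carrier_mat])
qed (simp_all add: mult_compound_def)

lemma mult_mat_vec_index_sum:
  assumes "A \<in> carrier_mat a b" "v \<in> carrier_vec b" "i < a"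
  shows "(A *\<^sub>v v) $ i = (\<Sum>j<b. A $$ (i, j) * v $ j)"
  using assms by (auto simp: scalar_prod_def lessThan_atLeast0 intro!: sum.cong)

text \<open>Both sides solve the linear system with coefficients \<open>A\<^bsup>[k]\<^esup>\<close> and agree at time \<open>0\<close>, where the compound of
the identity is the identity. Their difference vanishes by uniqueness.\<close>

theorem compound_system_solution:
  fixes \<Phi> A :: "real \<Rightarrow> real Matrix.mat"
  assumes \<Phi>: "\<And>t. \<Phi> t \<in> carrier_mat n n" and A: "\<And>t. A t \<in> carrier_mat n n"
    and \<Phi>_deriv: "\<And>t r c. 0 \<le> t \<Longrightarrow> r < n \<Longrightarrow> c < n \<Longrightarrow>
      ((\<lambda>s. \<Phi> s $$ (r, c)) has_real_derivative (A t * \<Phi> t) $$ (r, c)) (at t within {0..})"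
    and A_cont: "\<And>r c. r < n \<Longrightarrow> c < n \<Longrightarrow> continuous_on {0..} (\<lambda>t. A t $$ (r, c))"
    and \<Phi>0: "\<Phi> 0 = 1\<^sub>m n"
    and y: "\<And>t. 0 \<le> t \<Longrightarrow> y t \<in> carrier_vec (n choose k)"
    and y_deriv: "\<And>t i. 0 \<le> t \<Longrightarrow> i < n choose k \<Longrightarrow>
      ((\<lambda>s. y s $ i) has_real_derivative (add_compound k (A t) *\<^sub>v y t) $ i) (at t within {0..})"
    and T: "0 \<le> T"
  shows "y T = mult_compound k (\<Phi> T) *\<^sub>v y 0"
proof (rule eq_vecI)
  let ?N = "n choose k"
  let ?z = "\<lambda>t i. \<Sum>j<?N. mult_compound k (\<Phi> t) $$ (i, j) * y 0 $ j"
  have z: "?z t i = (mult_compound k (\<Phi> t) *\<^sub>v y 0) $ i" if "i < ?N" for t i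
    using mult_mat_vec_index_sum[OF carrier_mult_compound[OF \<Phi>] y that] by simp
  fix i assume "i < dim_vec (mult_compound k (\<Phi> T) *\<^sub>v y 0)"
  then have i: "i < ?N" using carrier_mult_compound[OF \<Phi>[of T], of k] by simp
  have "y T $ i - ?z T i = 0"
  proof (rule linear_system_zero[where u = "\<lambda>t i. y t $ i - ?z t i" and a = "\<lambda>t i j. add_compound k (A t) $$ (i, j)" and r = ?N])
    fix t :: real and i assume t: "0 \<le> t" and i: "i < ?N"
    let ?a = "add_compound k (A t)"
    have "((\<lambda>s. ?z s i) has_real_derivative
        (\<Sum>j<?N. (?a * mult_compound k (\<Phi> t)) $$ (i, j) * y 0 $ j)) (at t within {0..})"
    proof (intro DERIV_sum DERIV_cmult_right)
      fix j assume "j \<in> {..<?N}"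
      then have j: "j < ?N" by simp
      show "((\<lambda>s. mult_compound k (\<Phi> s) $$ (i, j)) has_real_derivative
          (?a * mult_compound k (\<Phi> t)) $$ (i, j)) (at t within {0..})"
        unfolding minor_differential_eq_add_compound_mult[OF A \<Phi> i j, symmetric]
        by (rule has_real_derivative_mult_compound[OF \<Phi> mult_carrier_mat[OF A \<Phi>] \<Phi>_deriv[OF t] i j])
    qed
    also have "(\<Sum>j<?N. (?a * mult_compound k (\<Phi> t)) $$ (i, j) * y 0 $ j)
        = ((?a * mult_compound k (\<Phi> t)) *\<^sub>v y 0) $ i"
      by (rule mult_mat_vec_index_sum[symmetric, OF mult_carrier_mat[OF carrier_add_compound[OF A]
            carrier_mult_compound[OF \<Phi>]] y[OF order_refl] i])
    also have "\<dots> = (?a *\<^sub>v (mult_compound k (\<Phi> t) *\<^sub>v y 0)) $ i"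
      using assoc_mult_mat_vec[OF carrier_add_compound[OF A] carrier_mult_compound[OF \<Phi>] y[OF order_refl]]
      by simp
    also have "\<dots> = (\<Sum>j<?N. ?a $$ (i, j) * (mult_compound k (\<Phi> t) *\<^sub>v y 0) $ j)"
      using mult_mat_vec_carrier[OF carrier_mult_compound[OF \<Phi>] y[of 0]]
      by (intro mult_mat_vec_index_sum[OF carrier_add_compound[OF A] _ i]) simp
    also have "\<dots> = (\<Sum>j<?N. ?a $$ (i, j) * ?z t j)"
      by (intro sum.cong refl) (simp add: z)
    finally have "((\<lambda>s. ?z s i) has_real_derivative (\<Sum>j<?N. ?a $$ (i, j) * ?z t j)) (at t within {0..})" .
    moreover have "((\<lambda>s. y s $ i) has_real_derivative (\<Sum>j<?N. ?a $$ (i, j) * y t $ j)) (at t within {0..})"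
      using y_deriv[OF t i] mult_mat_vec_index_sum[OF carrier_add_compound[OF A] y[OF t] i] by simp
    ultimately have "((\<lambda>s. y s $ i - ?z s i) has_real_derivative
        (\<Sum>j<?N. ?a $$ (i, j) * y t $ j) - (\<Sum>j<?N. ?a $$ (i, j) * ?z t j)) (at t within {0..})"
      by (rule DERIV_diff[rotated])
    then show "((\<lambda>s. y s $ i - ?z s i) has_real_derivative
        (\<Sum>j<?N. ?a $$ (i, j) * (y t $ j - ?z t j))) (at t within {0..})"
      by (simp add: right_diff_distrib sum_subtractf)
  next
    fix i assume "i < ?N"
    then show "y 0 $ i - ?z 0 i = 0"
      using z[of i 0] y[of 0] by (simp add: \<Phi>0 mult_compound_one)
  qed (use continuous_on_add_compound[OF A A_cont] T i in auto)
  then show "y T $ i = (mult_compound k (\<Phi> T) *\<^sub>v y 0) $ i"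
    using z[OF i] by simp
qed (use y[OF T] carrier_mult_compound[OF \<Phi>, of k T] in simp)

section \<open>Minors with small rows\<close>

text \<open>Every term of the Leibniz expansion contains exactly one factor from the small row.\<close>

lemma abs_det_le_small_row:
  fixes A :: "real Matrix.mat"
  assumes A: "A \<in> carrier_mat k k" and B: "0 \<le> B"
    and le: "\<And>i j. i < k \<Longrightarrow> j < k \<Longrightarrow> \<bar>A $$ (i, j)\<bar> \<le> B"
    and row: "r < k" "\<And>j. j < k \<Longrightarrow> \<bar>A $$ (r, j)\<bar> \<le> B * e"
  shows "\<bar>Determinant.det A\<bar> \<le> fact k * B ^ k * e"
proof -
  have "\<bar>Determinant.det A\<bar> \<le> (\<Sum>p | p permutes {0..<k}. \<bar>signof p * (\<Prod>i = 0..<k. A $$ (i, p i))\<bar>)"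
    unfolding det_def'[OF A] by (rule sum_abs)
  also have "\<dots> \<le> (\<Sum>p | p permutes {0..<k}. B ^ k * e)"
  proof (intro sum_mono)
    fix p assume "p \<in> {p. p permutes {0..<k}}"
    then have p: "p i < k" if "i < k" for i
      using permutes_in_image[of p "{0..<k}" i] that by simp
    have "\<bar>signof p * (\<Prod>i = 0..<k. A $$ (i, p i))\<bar> = (\<Prod>i = 0..<k. \<bar>A $$ (i, p i)\<bar>)"
      by (simp add: abs_mult abs_prod sign_def)
    also have "\<dots> = \<bar>A $$ (r, p r)\<bar> * (\<Prod>i\<in>{0..<k} - {r}. \<bar>A $$ (i, p i)\<bar>)"
      using row(1) by (intro prod.remove) auto
    also have "\<dots> \<le> (B * e) * (\<Prod>i\<in>{0..<k} - {r}. B)"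
    proof (rule mult_mono)
      show "\<bar>A $$ (r, p r)\<bar> \<le> B * e" using row p by simp
      then show "0 \<le> B * e" by linarith
      show "(\<Prod>i\<in>{0..<k} - {r}. \<bar>A $$ (i, p i)\<bar>) \<le> (\<Prod>i\<in>{0..<k} - {r}. B)"
        using le p by (intro prod_mono) auto
    qed (auto intro: prod_nonneg)
    also have "\<dots> = B ^ k * e" using row(1) by (cases k) simp_all
    finally show "\<bar>signof p * (\<Prod>i = 0..<k. A $$ (i, p i))\<bar> \<le> B ^ k * e" .
  qed
  also have "\<dots> = fact k * B ^ k * e"
    by (simp add: card_permutations)
  finally show ?thesis .
qed

text \<open>Fewer than \<open>k\<close> rows lie outside the first \<open>l\<close>, so any \<open>k\<close> rows include a small one.\<close>

lemma abs_mult_compound_le_small_rows: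
  assumes A: "A \<in> carrier_mat n n" and B: "0 \<le> B"
    and le: "\<And>r c. r < n \<Longrightarrow> c < n \<Longrightarrow> \<bar>A $$ (r, c)\<bar> \<le> B"
    and rows: "\<And>r c. r < l \<Longrightarrow> c < n \<Longrightarrow> \<bar>A $$ (r, c)\<bar> \<le> B * e" and l: "n < k + l" and "0 < k"
    and i: "i < n choose k" and j: "j < n choose k"
  shows "\<bar>mult_compound k A $$ (i, j)\<bar> \<le> fact k * B ^ k * e"
proof -
  let ?I = "lex_subsets n k ! i"
  have I: "?I \<subseteq> {0..<n}" "card ?I = k" using lex_subsets_nth[OF i] .
  then have fin: "finite ?I" using finite_subset by auto
  have "\<exists>s\<in>?I. s < l"
  proof (rule ccontr)
    assume none: "\<not> (\<exists>s\<in>?I. s < l)"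
    have "?I \<subseteq> {l..<n}"
    proof
      fix s assume "s \<in> ?I"
      then show "s \<in> {l..<n}" using subsetD[OF I(1)] none by (auto simp: not_less)
    qed
    then have "k \<le> n - l" using I card_mono[of "{l..<n}" ?I] by simp
    then show False using l \<open>0 < k\<close> by linarith
  qed
  then obtain s where s: "s \<in> ?I" "s < l" by blast
  then have "s \<in> pick ?I ` {0..<k}"
    using bij_betw_imp_surj_on[OF bij_betw_pick[OF fin]] I(2) by simp
  then obtain r where r: "r < k" "pick ?I r < l" using s(2) by auto
  show ?thesis
    unfolding mult_compound_index[OF A i j]
    by (rule abs_det_le_small_row[where r = r])
      (auto simp: minor_mat_index[OF A] B r intro!: le rows pick_lex_subsets_less[OF i] pick_lex_subsets_less[OF j])
qed

section \<open>Monotonic norms\<close>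

text \<open>Monotonicity yields equivalence with the maximum norm directly: \<open>v\<close> dominates \<open>|v\<^sub>i| e\<^sub>i\<close> and is
dominated by a multiple of the vector of ones.\<close>

lemma monotonic_norm_coordinates:
  assumes p: "monotonic_norm m p"
  obtains C where "0 < C"
    "\<And>v i. v \<in> carrier_vec m \<Longrightarrow> i < m \<Longrightarrow> \<bar>v $ i\<bar> \<le> C * p v"
    "\<And>v B. v \<in> carrier_vec m \<Longrightarrow> 0 \<le> B \<Longrightarrow> (\<And>i. i < m \<Longrightarrow> \<bar>v $ i\<bar> \<le> B) \<Longrightarrow> p v \<le> C * B"
proof -
  have nonneg: "0 \<le> p v" and zero: "p v = 0 \<longleftrightarrow> v = 0\<^sub>v m" and scale: "p (r \<cdot>\<^sub>v v) = \<bar>r\<bar> * p v"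
    if "v \<in> carrier_vec m" for v r
    using p that unfolding monotonic_norm_def vector_norm_def by blast+
  have mono: "p v \<le> p w" if "v \<in> carrier_vec m" "w \<in> carrier_vec m" "\<And>i. i < m \<Longrightarrow> \<bar>v $ i\<bar> \<le> \<bar>w $ i\<bar>" for v w
    using p that unfolding monotonic_norm_def by blast
  let ?one = "Matrix.vec m (\<lambda>_. 1 :: real)"
  define C where "C = 1 + p ?one + (\<Sum>i<m. 1 / p (unit_vec m i))"
  have unit: "0 < p (unit_vec m i)" if "i < m" for i
  proof -
    have "(unit_vec m i :: real Matrix.vec) $ i \<noteq> 0\<^sub>v m $ i" using that by simp
    then have "(unit_vec m i :: real Matrix.vec) \<noteq> 0\<^sub>v m" by metis
    then show ?thesis
      using nonneg[of "unit_vec m i"] zero[of "unit_vec m i"] by (simp add: less_le)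
  qed
  have one: "0 \<le> p ?one" by (rule nonneg) simp
  have C: "0 < C" unfolding C_def
    using one unit by (intro add_pos_nonneg sum_nonneg) (auto simp: less_imp_le)
  show ?thesis
  proof (rule that)
    show "0 < C" by fact
    fix v :: "real Matrix.vec" and i assume v: "v \<in> carrier_vec m" and i: "i < m"
    have "\<bar>v $ i\<bar> * p (unit_vec m i) = p (v $ i \<cdot>\<^sub>v unit_vec m i)"
      using i by (simp add: scale)
    also have "\<dots> \<le> p v"
      using v i by (intro mono) (auto simp: unit_vec_def)
    finally have "\<bar>v $ i\<bar> \<le> (1 / p (unit_vec m i)) * p v"
      using unit[OF i] by (simp add: field_simps)
    moreover have "1 / p (unit_vec m i) \<le> (\<Sum>i<m. 1 / p (unit_vec m i))"
      using i unit by (intro member_le_sum[of i "{..<m}" "\<lambda>i. 1 / p (unit_vec m i)"]) (auto simp: less_imp_le)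
    then have "1 / p (unit_vec m i) \<le> C" using one unfolding C_def by linarith
    ultimately show "\<bar>v $ i\<bar> \<le> C * p v"
      using nonneg[OF v] by (meson mult_right_mono order_trans)
  next
    fix v :: "real Matrix.vec" and B :: real
    assume v: "v \<in> carrier_vec m" and B: "0 \<le> B" "\<And>i. i < m \<Longrightarrow> \<bar>v $ i\<bar> \<le> B"
    have "p v \<le> p (B \<cdot>\<^sub>v ?one)"
      using v B by (intro mono) auto
    also have "\<dots> = p ?one * B" using B by (simp add: scale)
    also have "\<dots> \<le> C * B"
      using B unit unfolding C_def
      by (intro mult_right_mono) (auto intro!: add_nonneg_nonneg sum_nonneg simp: less_imp_le)
    finally show "p v \<le> C * B" .
  qed
qed

lemma monotonic_norm_nonneg:
  "monotonic_norm m p \<Longrightarrow> v \<in> carrier_vec m \<Longrightarrow> 0 \<le> p v"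
  by (simp add: monotonic_norm_def vector_norm_def)

lemma monotonic_norm_dominated:
  assumes p: "monotonic_norm m p" and q: "monotonic_norm m q"
  obtains C where "0 < C" "\<And>v. v \<in> carrier_vec m \<Longrightarrow> p v \<le> C * q v"
proof -
  obtain Cp where Cp: "0 < Cp" "\<And>v B. v \<in> carrier_vec m \<Longrightarrow> 0 \<le> B \<Longrightarrow>
      (\<And>i. i < m \<Longrightarrow> \<bar>v $ i\<bar> \<le> B) \<Longrightarrow> p v \<le> Cp * B"
    using monotonic_norm_coordinates[OF p] by metis
  obtain Cq where Cq: "0 < Cq" "\<And>v i. v \<in> carrier_vec m \<Longrightarrow> i < m \<Longrightarrow> \<bar>v $ i\<bar> \<le> Cq * q v"
    using monotonic_norm_coordinates[OF q] by metis
  have "p v \<le> Cp * Cq * q v" if "v \<in> carrier_vec m" for v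
    using Cp(2)[OF that, of "Cq * q v"] Cq that monotonic_norm_nonneg[OF q that]
    by (simp add: mult.assoc)
  then show ?thesis using that[of "Cp * Cq"] Cp(1) Cq(1) by simp
qed

section \<open>Coordinate vectors and the moving frame\<close>

lemma bij_betw_coord: "bij_betw (coord :: nat \<Rightarrow> 'n::{finite,linorder}) {..<CARD('n)} UNIV"
proof -
  have "bij_betw ((!) (sorted_list_of_set (UNIV :: 'n set))) {..<CARD('n)} UNIV"
    by (intro bij_betw_nth) simp_all
  then show ?thesis by (simp add: coord_def[abs_def])
qed

lemma sum_coord: "(\<Sum>i<CARD('n::{finite,linorder}). g (coord i :: 'n)) = (\<Sum>j\<in>UNIV. g j)"
  by (rule sum.reindex_bij_betw[OF bij_betw_coord])

lemma carrier_to_vec [simp]: "to_vec (v :: 'n::{finite,linorder} state) \<in> carrier_vec CARD('n)"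
  by (simp add: to_vec_def)

lemma carrier_to_mat [simp]:
  "to_mat (A :: ('n::{finite,linorder} state, 'n) Finite_Cartesian_Product.vec) \<in> carrier_mat CARD('n) CARD('n)"
  by (simp add: to_mat_def)

lemma to_vec_index: "i < CARD('n) \<Longrightarrow> to_vec (v :: 'n::{finite,linorder} state) $ i = vec_nth v (coord i)"
  by (simp add: to_vec_def)

lemma to_vec_mult:
  fixes A :: "('n::{finite,linorder} state, 'n) Finite_Cartesian_Product.vec"
  shows "to_vec (A *v v) = to_mat A *\<^sub>v to_vec v"
proof (rule eq_vecI)
  fix i assume "i < dim_vec (to_mat A *\<^sub>v to_vec v)"
  then have i: "i < CARD('n)" by (simp add: to_mat_def)
  have "(to_mat A *\<^sub>v to_vec v) $ i =
      (\<Sum>j<CARD('n). vec_nth (vec_nth A (coord i)) (coord j) * vec_nth v (coord j))"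
    using i by (simp add: mult_mat_vec_index_sum[of _ "CARD('n)" "CARD('n)"])
      (simp add: to_mat_def to_vec_def)
  also have "\<dots> = (\<Sum>j\<in>UNIV. vec_nth (vec_nth A (coord i)) j * vec_nth v j)"
    by (rule sum_coord)
  finally show "to_vec (A *v v) $ i = (to_mat A *\<^sub>v to_vec v) $ i"
    using i by (simp add: to_vec_index matrix_vector_mult_def)
qed (simp add: to_mat_def to_vec_def)

lemma scalar_prod_to_vec:
  "scalar_prod (to_vec u) (to_vec v) = inner u (v :: 'n::{finite,linorder} state)"
  using sum_coord[where 'n = 'n and g = "\<lambda>j. vec_nth u j * vec_nth v j"]
  by (simp add: scalar_prod_def to_vec_def inner_vec_def lessThan_atLeast0)

lemma abs_to_vec_le_norm:
  fixes v :: "'n::{finite,linorder} state"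
  shows "i < CARD('n) \<Longrightarrow> \<bar>to_vec v $ i\<bar> \<le> norm v"
  by (simp add: to_vec_index component_le_norm_cart)

lemma norm_le_of_to_vec_le:
  fixes v :: "'n::{finite,linorder} state" and B :: real
  assumes "\<And>i. i < CARD('n) \<Longrightarrow> \<bar>to_vec v $ i\<bar> \<le> B"
  shows "norm v \<le> CARD('n) * B"
proof -
  have "norm v \<le> (\<Sum>j\<in>UNIV. \<bar>vec_nth v j\<bar>)" by (rule norm_le_l1_cart)
  also have "\<dots> = (\<Sum>i<CARD('n). \<bar>vec_nth v (coord i)\<bar>)" by (rule sum_coord[symmetric])
  also have "\<dots> \<le> (\<Sum>i<CARD('n). B)" using assms by (intro sum_mono) (simp add: to_vec_index)
  finally show ?thesis by simp
qed

lemma carrier_field_matrix [simp]: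
  "field_matrix m g (z :: 'n::{finite,linorder} state) \<in> carrier_mat CARD('n) m"
  by (simp add: field_matrix_def mat_of_cols_def)

lemma col_field_matrix:
  "j < m \<Longrightarrow> col (field_matrix m g (z :: 'n::{finite,linorder} state)) j = to_vec (g j z)"
  by (simp add: field_matrix_def)

text \<open>The square matrix with blocks \<open>H\<^sup>T\<close> and \<open>Q\<^sup>T\<close> is injective, hence invertible. So is its transpose, whose
columns are those of \<open>H\<close> and \<open>Q\<close>. For the frame at a point of \<open>\<Omega>\<close> this means that every vector of the
ambient space splits into a horizontal and a vertical part.\<close>

lemma stacked_transpose_solvable:
  fixes H Q :: "real Matrix.mat"
  assumes H: "H \<in> carrier_mat n l" and Q: "Q \<in> carrier_mat n m" and n: "n = l + m"
    and inj: "\<And>v. v \<in> carrier_vec n \<Longrightarrow>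
      (transpose_mat H @\<^sub>r transpose_mat Q) *\<^sub>v v = 0\<^sub>v n \<Longrightarrow> v = 0\<^sub>v n"
    and v: "v \<in> carrier_vec n"
  obtains a b where "a \<in> carrier_vec l" "b \<in> carrier_vec m" "v = H *\<^sub>v a + Q *\<^sub>v b"
proof -
  define M where "M = transpose_mat H @\<^sub>r transpose_mat Q"
  have M: "M \<in> carrier_mat n n"
    unfolding M_def n using H Q by (simp add: n)
  have "Determinant.det M \<noteq> 0"
    using inj det_0_iff_vec_prod_zero[OF M] unfolding M_def by blast
  then have "Determinant.det (transpose_mat M) \<noteq> 0" by (simp add: det_transpose[OF M])
  then obtain B where B: "B \<in> carrier_mat n n" "transpose_mat M * B = 1\<^sub>m n"
    using det_non_zero_imp_unit[of "transpose_mat M" n "()"] M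
    by (auto simp: Units_def ring_mat_def)
  define w where "w = B *\<^sub>v v"
  have w: "w \<in> carrier_vec n" using B v by (auto simp: w_def)
  have Mw: "transpose_mat M *\<^sub>v w = v"
    unfolding w_def using assoc_mult_mat_vec[of "transpose_mat M" n n B n v] B v M by simp
  define a b where "a = vec_first w l" and "b = vec_last w m"
  have ab: "a \<in> carrier_vec l" "b \<in> carrier_vec m" "w = a @\<^sub>v b"
    using w n by (simp_all add: a_def b_def)
  have "v $ i = (H *\<^sub>v a + Q *\<^sub>v b) $ i" if i: "i < n" for i
  proof -
    have "col M i = row H i @\<^sub>v row Q i"
      using H Q i M unfolding M_def
      by (intro eq_vecI) (auto simp: append_rows_def n)
    then have "(transpose_mat M *\<^sub>v w) $ i = scalar_prod (row H i) a + scalar_prod (row Q i) b"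
      using M H Q i ab by (simp add: scalar_prod_append[of _ l _ m])
    then show ?thesis using Mw H Q i by simp
  qed
  then have "v = H *\<^sub>v a + Q *\<^sub>v b"
    using v H Q by (intro eq_vecI) auto
  then show ?thesis using that ab by blast
qed

lemma transpose_field_matrix_mult_eq_zero:
  fixes z :: "'n::{finite,linorder} state"
  assumes "\<And>i j. i < l \<Longrightarrow> j < m \<Longrightarrow> inner (h i z) (q j z) = 0"
  shows "transpose_mat (field_matrix l h z) * field_matrix m q z = 0\<^sub>m l m"
proof (rule eq_matI)
  fix i j assume "i < dim_row (0\<^sub>m l m :: real Matrix.mat)" "j < dim_col (0\<^sub>m l m :: real Matrix.mat)"
  then have ij: "i < l" "j < m" by simp_all
  then have "(transpose_mat (field_matrix l h z) * field_matrix m q z) $$ (i, j)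
      = scalar_prod (col (field_matrix l h z) i) (col (field_matrix m q z) j)"
    using carrier_matD[OF carrier_field_matrix[of l h z]] carrier_matD[OF carrier_field_matrix[of m q z]] by simp
  then show "(transpose_mat (field_matrix l h z) * field_matrix m q z) $$ (i, j) = 0\<^sub>m l m $$ (i, j)"
    using ij assms by (simp add: col_field_matrix scalar_prod_to_vec)
qed (use carrier_matD[OF carrier_field_matrix[of l h z]] carrier_matD[OF carrier_field_matrix[of m q z]] in simp_all)

lemma horizontal_projection:
  fixes z :: "'n::{finite,linorder} state"
  assumes orth: "\<And>i j. i < l \<Longrightarrow> j < CARD('n) - l \<Longrightarrow> inner (h i z) (q j z) = 0"
    and dec: "decomposes l h q z v v\<^sub>h v\<^sub>q"
  shows "transpose_mat (field_matrix l h z) *\<^sub>v to_vec v =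
    (transpose_mat (field_matrix l h z) * field_matrix l h z) *\<^sub>v v\<^sub>h"
proof -
  let ?m = "CARD('n) - l"
  let ?H = "field_matrix l h z" and ?Q = "field_matrix ?m q z"
  have H: "?H \<in> carrier_mat CARD('n) l" "transpose_mat ?H \<in> carrier_mat l CARD('n)"
    and Q: "?Q \<in> carrier_mat CARD('n) ?m" by simp_all
  have vh: "v\<^sub>h \<in> carrier_vec l" and vq: "v\<^sub>q \<in> carrier_vec ?m"
    and v: "to_vec v = ?H *\<^sub>v v\<^sub>h + ?Q *\<^sub>v v\<^sub>q"
    using dec by (simp_all add: decomposes_def)
  have "transpose_mat ?H *\<^sub>v to_vec v =
      (transpose_mat ?H * ?H) *\<^sub>v v\<^sub>h + (transpose_mat ?H * ?Q) *\<^sub>v v\<^sub>q"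
    unfolding v using mult_add_distrib_mat_vec[OF H(2) mult_mat_vec_carrier[OF H(1) vh] mult_mat_vec_carrier[OF Q vq]]
    by (simp add: assoc_mult_mat_vec[OF H(2) H(1) vh] assoc_mult_mat_vec[OF H(2) Q vq])
  also have "(transpose_mat ?H * ?Q) *\<^sub>v v\<^sub>q = 0\<^sub>v l"
    using transpose_field_matrix_mult_eq_zero[where l = l and m = ?m and h = h and q = q and z = z, OF orth] vq
    by (intro eq_vecI) simp_all
  also have "(transpose_mat ?H * ?H) *\<^sub>v v\<^sub>h + 0\<^sub>v l = (transpose_mat ?H * ?H) *\<^sub>v v\<^sub>h"
    using vh by (intro right_zero_vec mult_mat_vec_carrier[OF mult_carrier_mat[OF H(2) H(1)]])
  finally show ?thesis .
qed

text \<open>Horizontal contraction bounds the coordinates \<open>\<delta>\<^sub>h\<close>. The bounds on \<open>H\<^sup>T H\<close> transfer this to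
\<open>H\<^sup>T \<delta> = H\<^sup>T H \<delta>\<^sub>h\<close>, which consists of the leading rows of \<open>M \<delta>\<close>.\<close>

lemma horizontal_projection_decay:
  fixes f :: "real \<Rightarrow> 'n::{finite,linorder} state \<Rightarrow> 'n state"
  assumes contr: "horizontally_contractive f \<Omega> x l h q"
    and orth: "\<And>z i j. z \<in> \<Omega> \<Longrightarrow> i < l \<Longrightarrow> j < CARD('n) - l \<Longrightarrow> inner (h i z) (q j z) = 0"
    and dec: "\<And>z v. z \<in> \<Omega> \<Longrightarrow> \<exists>v\<^sub>h v\<^sub>q. decomposes l h q z v v\<^sub>h v\<^sub>q"
    and inv: "\<And>a t. a \<in> \<Omega> \<Longrightarrow> 0 \<le> t \<Longrightarrow> x t a \<in> \<Omega>"
    and N: "monotonic_norm l N" and c: "0 < c1" "0 < c2"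
    and gram: "\<And>z y. z \<in> \<Omega> \<Longrightarrow> y \<in> carrier_vec l \<Longrightarrow>
      c1 * N y \<le> N ((transpose_mat (field_matrix l h z) * field_matrix l h z) *\<^sub>v y) \<and>
      N ((transpose_mat (field_matrix l h z) * field_matrix l h z) *\<^sub>v y) \<le> c2 * N y"
  obtains K \<eta> where "0 < K" "0 < \<eta>"
    "\<And>a \<delta> t. a \<in> \<Omega> \<Longrightarrow> variational_solution f (\<lambda>t. x t a) \<delta> \<Longrightarrow> 0 \<le> t \<Longrightarrow>
      N (transpose_mat (field_matrix l h (x t a)) *\<^sub>v to_vec (\<delta> t)) \<le>
      K * exp (- \<eta> * t) * N (transpose_mat (field_matrix l h (x 0 a)) *\<^sub>v to_vec (\<delta> 0))"
proof -
  obtain c \<eta> p where "1 \<le> c" "0 < \<eta>" and p: "monotonic_norm l p"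
    and decay: "\<And>a \<delta> \<delta>\<^sub>h \<delta>\<^sub>q t. a \<in> \<Omega> \<Longrightarrow> variational_solution f (\<lambda>t. x t a) \<delta> \<Longrightarrow>
      (\<And>t. 0 \<le> t \<Longrightarrow> decomposes l h q (x t a) (\<delta> t) (\<delta>\<^sub>h t) (\<delta>\<^sub>q t)) \<Longrightarrow> 0 \<le> t \<Longrightarrow>
      p (\<delta>\<^sub>h t) \<le> c * exp (- \<eta> * t) * p (\<delta>\<^sub>h 0)"
    using contr unfolding horizontally_contractive_def by blast
  obtain C1 where C1: "0 < C1" "\<And>v. v \<in> carrier_vec l \<Longrightarrow> N v \<le> C1 * p v"
    using monotonic_norm_dominated[OF N p] by blast
  obtain C2 where C2: "0 < C2" "\<And>v. v \<in> carrier_vec l \<Longrightarrow> p v \<le> C2 * N v"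
    using monotonic_norm_dominated[OF p N] by blast
  let ?K = "c2 * C1 * c * C2 / c1"
  show ?thesis
  proof (rule that[of ?K \<eta>])
    show "0 < ?K" using c C1 C2 \<open>1 \<le> c\<close> by simp
    show "0 < \<eta>" by fact
    fix a \<delta> and t :: real
    assume a: "a \<in> \<Omega>" and var: "variational_solution f (\<lambda>t. x t a) \<delta>" and t: "0 \<le> t"
    \<comment> \<open>a pair of coordinate vectors, chosen separately at every time\<close>
    have "\<exists>w. 0 \<le> s \<longrightarrow> decomposes l h q (x s a) (\<delta> s) (fst w) (snd w)" for s
      using dec[OF inv[OF a], of s "\<delta> s"] by (metis fst_conv snd_conv)
    then obtain w where w: "\<And>s. 0 \<le> s \<Longrightarrow> decomposes l h q (x s a) (\<delta> s) (fst (w s)) (snd (w s))"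
      by metis
    have carr: "fst (w s) \<in> carrier_vec l" if "0 \<le> s" for s
      using w[OF that] by (simp add: decomposes_def)
    let ?P = "\<lambda>s. transpose_mat (field_matrix l h (x s a)) *\<^sub>v to_vec (\<delta> s)"
    have P: "?P s = (transpose_mat (field_matrix l h (x s a)) * field_matrix l h (x s a)) *\<^sub>v fst (w s)"
      if "0 \<le> s" for s
      using horizontal_projection[OF orth[OF inv[OF a that]] w[OF that]] by simp
    have "N (?P t) \<le> c2 * N (fst (w t))"
      unfolding P[OF t] using gram[OF inv[OF a t] carr[OF t]] by simp
    also have "\<dots> \<le> c2 * (C1 * p (fst (w t)))"
      using c C1(2)[OF carr[OF t]] by simp
    also have "\<dots> \<le> c2 * (C1 * (c * exp (- \<eta> * t) * p (fst (w 0))))"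
      using c C1(1) decay[OF a var, of "\<lambda>s. fst (w s)" "\<lambda>s. snd (w s)", OF w t]
      by (intro mult_left_mono) auto
    also have "p (fst (w 0)) \<le> C2 * N (fst (w 0))"
      using C2(2) carr by simp
    also have "N (fst (w 0)) \<le> N (?P 0) / c1"
      using gram[OF inv[OF a order_refl] carr[OF order_refl]] c
      by (simp add: P pos_le_divide_eq mult.commute)
    finally show "N (?P t) \<le> ?K * exp (- \<eta> * t) * N (?P 0)"
      using c C1 C2 \<open>1 \<le> c\<close> by (simp add: mult_ac)
  qed
qed

lemma fundamental_solutions_exist:
  fixes A :: "real \<Rightarrow> ('n::{finite,linorder} state, 'n) Finite_Cartesian_Product.vec"
  assumes "continuous_on {0..} A"
  obtains \<delta> :: "nat \<Rightarrow> real \<Rightarrow> 'n state" where "\<And>j. \<delta> j 0 = axis (coord j) 1"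
    "\<And>j t. 0 \<le> t \<Longrightarrow> (\<delta> j has_vector_derivative A t *v \<delta> j t) (at t within {0..})"
proof -
  have "\<exists>d. d 0 = axis (coord j) 1 \<and>
      (\<forall>t\<ge>0. (d has_vector_derivative A t *v d t) (at t within {0..}))" for j
    using linear_ode_solution_exists[OF assms, of "axis (coord j) 1"] by blast
  then show ?thesis using that by metis
qed

section \<open>From horizontal contraction to \<open>k\<close>-contraction\<close>

theorem theorem2:
  fixes f :: "real \<Rightarrow> 'n::{finite,linorder} state \<Rightarrow> 'n state"
    and \<Omega> :: "'n state set"
    and x :: "real \<Rightarrow> 'n state \<Rightarrow> 'n state"
    and k l :: nat
    and h q :: "nat \<Rightarrow> 'n state \<Rightarrow> 'n state"
    and N :: "nat \<Rightarrow> real Matrix.vec \<Rightarrow> real"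
    and H Q M :: "'n state \<Rightarrow> real Matrix.mat"
    and c1 c2 c3 c4 c5 c6 \<gamma>1 :: real
  assumes "C1_in_state f"
    and "closed \<Omega>" "connected \<Omega>" "full_dim_manifold \<Omega>"
    and "solution_map f \<Omega> x"
    and "k \<in> {1..CARD('n)}" and "l = CARD('n) - k + 1"
    and "horizontal_vertical \<Omega> l h q"
    and "horizontally_contractive f \<Omega> x l h q"
    and "\<And>z. H z = field_matrix l h z"
    and "\<And>z. Q z = field_matrix (k - 1) q z"
    and "\<And>z. M z = transpose_mat (H z) @\<^sub>r transpose_mat (Q z)"
    and "\<And>m. monotonic_norm m (N m)"
    and "c1 > 0" "c2 > 0" "c3 > 0" "c4 > 0" "c5 > 0" "c6 > 0"
    and "\<And>z y. z \<in> \<Omega> \<Longrightarrow> y \<in> carrier_vec l \<Longrightarrow>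
      c1 * N l y \<le> N l ((transpose_mat (H z) * H z) *\<^sub>v y) \<and>
      N l ((transpose_mat (H z) * H z) *\<^sub>v y) \<le> c2 * N l y"
    and "\<And>z y. z \<in> \<Omega> \<Longrightarrow> y \<in> carrier_vec CARD('n) \<Longrightarrow>
      c3 * N CARD('n) y \<le> N CARD('n) (M z *\<^sub>v y) \<and>
      N CARD('n) (M z *\<^sub>v y) \<le> c4 * N CARD('n) y"
    and "\<And>z y. z \<in> \<Omega> \<Longrightarrow> y \<in> carrier_vec (CARD('n) choose k) \<Longrightarrow>
      c5 * N (CARD('n) choose k) y \<le> N (CARD('n) choose k) (mult_compound k (M z) *\<^sub>v y) \<and>
      N (CARD('n) choose k) (mult_compound k (M z) *\<^sub>v y) \<le> c6 * N (CARD('n) choose k) y"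
    and "\<gamma>1 > 1"
    and "\<And>a b t. a \<in> \<Omega> \<Longrightarrow> b \<in> \<Omega> \<Longrightarrow> t \<ge> 0 \<Longrightarrow>
      N CARD('n) (to_vec (x t a - x t b)) \<le> \<gamma>1 * N CARD('n) (to_vec (x 0 a - x 0 b))"
  shows "k_contractive k f \<Omega> x"
proof -
  let ?n = "CARD('n)" and ?r = "CARD('n) choose k"
  note C1 = assms(1) and sol = assms(5) and frame = assms(8)
    and H = assms(10) and Q = assms(11) and M = assms(12) and N = assms(13)
    and c = assms(14-19) and gram = assms(20) and M_bounds = assms(21) and Mk_bounds = assms(22)
    and \<gamma>1 = assms(23) and lip_N = assms(24)
  have k: "0 < k" "?n = l + (k - 1)" "?n - l = k - 1" "?n < k + l"
    using assms(6,7) by auto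
  have H_carr: "H z \<in> carrier_mat ?n l" and Q_carr: "Q z \<in> carrier_mat ?n (k - 1)" for z
    by (simp_all add: H Q)
  have M_carr: "M z \<in> carrier_mat ?n ?n" for z
    using carrier_append_rows[of "transpose_mat (H z)" l ?n "transpose_mat (Q z)" "k - 1"] H_carr Q_carr
    unfolding M k(2)[symmetric] by simp
  have inv: "x t a \<in> \<Omega>" if "a \<in> \<Omega>" "0 \<le> t" for a t
    using sol that by (simp add: solution_map_def)
  have orth: "inner (h i z) (q j z) = 0" if "z \<in> \<Omega>" "i < l" "j < ?n - l" for z i j
    using frame that by (simp add: horizontal_vertical_def)
  \<comment> \<open>the lower bound on \<open>M\<close> makes it injective\<close>
  have dec: "\<exists>v\<^sub>h v\<^sub>q. decomposes l h q z v v\<^sub>h v\<^sub>q" if z: "z \<in> \<Omega>" for z v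
  proof -
    have "w = 0\<^sub>v ?n" if w: "w \<in> carrier_vec ?n" "M z *\<^sub>v w = 0\<^sub>v ?n" for w
    proof -
      have N0: "N ?n u = 0 \<longleftrightarrow> u = 0\<^sub>v ?n" if "u \<in> carrier_vec ?n" for u
        using N[of ?n] that by (simp add: monotonic_norm_def vector_norm_def)
      have "c3 * N ?n w \<le> 0"
        using M_bounds[OF z w(1)] N0[of "0\<^sub>v ?n"] w(2) by simp
      then have "N ?n w = 0"
        using c monotonic_norm_nonneg[OF N w(1)] by (simp add: mult_le_0_iff)
      then show ?thesis using N0[OF w(1)] by simp
    qed
    then obtain a b where "a \<in> carrier_vec l" "b \<in> carrier_vec (k - 1)"
      "to_vec v = H z *\<^sub>v a + Q z *\<^sub>v b"
      using stacked_transpose_solvable[OF H_carr[of z] Q_carr[of z] k(2) _ carrier_to_vec[of v]]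
      unfolding M by blast
    then have "decomposes l h q z v a b"
      by (simp add: decomposes_def H Q k(3))
    then show ?thesis by blast
  qed
  obtain K \<eta> where "0 < K" "0 < \<eta>" and decay: "\<And>a \<delta> t. a \<in> \<Omega> \<Longrightarrow>
      variational_solution f (\<lambda>t. x t a) \<delta> \<Longrightarrow> 0 \<le> t \<Longrightarrow>
      N l (transpose_mat (H (x t a)) *\<^sub>v to_vec (\<delta> t)) \<le>
      K * exp (- \<eta> * t) * N l (transpose_mat (H (x 0 a)) *\<^sub>v to_vec (\<delta> 0))"
    using horizontal_projection_decay[OF assms(9) orth dec inv N[of l] c(1,2) gram[unfolded H]]
    unfolding H by blast
  obtain Cn where Cn: "0 < Cn" "\<And>v i. v \<in> carrier_vec ?n \<Longrightarrow> i < ?n \<Longrightarrow> \<bar>v $ i\<bar> \<le> Cn * N ?n v"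
    "\<And>v B. v \<in> carrier_vec ?n \<Longrightarrow> 0 \<le> B \<Longrightarrow> (\<And>i. i < ?n \<Longrightarrow> \<bar>v $ i\<bar> \<le> B) \<Longrightarrow> N ?n v \<le> Cn * B"
    by (rule monotonic_norm_coordinates[OF N[of ?n]]) blast
  obtain Cl where Cl: "0 < Cl" "\<And>v i. v \<in> carrier_vec l \<Longrightarrow> i < l \<Longrightarrow> \<bar>v $ i\<bar> \<le> Cl * N l v"
    "\<And>v B. v \<in> carrier_vec l \<Longrightarrow> 0 \<le> B \<Longrightarrow> (\<And>i. i < l \<Longrightarrow> \<bar>v $ i\<bar> \<le> B) \<Longrightarrow> N l v \<le> Cl * B"
    by (rule monotonic_norm_coordinates[OF N[of l]]) blast
  obtain Cr where Cr: "0 < Cr" "\<And>v i. v \<in> carrier_vec ?r \<Longrightarrow> i < ?r \<Longrightarrow> \<bar>v $ i\<bar> \<le> Cr * N ?r v"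
    "\<And>v B. v \<in> carrier_vec ?r \<Longrightarrow> 0 \<le> B \<Longrightarrow> (\<And>i. i < ?r \<Longrightarrow> \<bar>v $ i\<bar> \<le> B) \<Longrightarrow> N ?r v \<le> Cr * B"
    by (rule monotonic_norm_coordinates[OF N[of ?r]]) blast
  \<comment> \<open>a Lipschitz constant of the flow for the Euclidean norm\<close>
  define L where "L = ?n * (Cn * (\<gamma>1 * Cn))"
  have L: "0 < L" using Cn(1) \<gamma>1 by (simp add: L_def)
  have lip: "norm (x t a - x t b) \<le> L * norm (a - b)" if ab: "a \<in> \<Omega>" "b \<in> \<Omega>" "0 \<le> t" for a b t
  proof -
    have "N ?n (to_vec (x t a - x t b)) \<le> \<gamma>1 * N ?n (to_vec (x 0 a - x 0 b))"
      using lip_N[OF ab] .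
    also have "\<dots> \<le> \<gamma>1 * (Cn * norm (x 0 a - x 0 b))"
      using \<gamma>1 by (intro mult_left_mono Cn(3)) (auto simp: abs_to_vec_le_norm)
    finally have "Cn * N ?n (to_vec (x t a - x t b)) \<le> Cn * (\<gamma>1 * (Cn * norm (x 0 a - x 0 b)))"
      using Cn(1) by simp
    then have "norm (x t a - x t b) \<le> ?n * (Cn * (\<gamma>1 * (Cn * norm (x 0 a - x 0 b))))"
      using Cn(2)[OF carrier_to_vec] by (intro norm_le_of_to_vec_le) (meson order_trans)
    then show ?thesis
      using sol ab by (simp add: L_def solution_map_def mult_ac)
  qed
  \<comment> \<open>a bound for all entries of \<open>M \<Phi>\<close>, from the upper bound on \<open>M\<close> and \<open>|\<delta>| \<le> L\<close>\<close>
  define B1 where "B1 = Cn * (c4 * (Cn * L))"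
  have "0 < B1" using Cn(1) c L by (simp add: B1_def)
  have frame_bound: "\<bar>(M z *\<^sub>v to_vec v) $ i\<bar> \<le> B1" if "z \<in> \<Omega>" "norm v \<le> L" "i < ?n" for z i and v :: "'n state"
  proof -
    have "\<bar>(M z *\<^sub>v to_vec v) $ i\<bar> \<le> Cn * N ?n (M z *\<^sub>v to_vec v)"
      using that(3) by (intro Cn(2) mult_mat_vec_carrier[OF M_carr]) auto
    also have "\<dots> \<le> Cn * (c4 * N ?n (to_vec v))"
      using M_bounds[OF that(1) carrier_to_vec[of v]] Cn(1) by simp
    also have "N ?n (to_vec v) \<le> Cn * L"
      using L that(2) abs_to_vec_le_norm[of _ v] by (intro Cn(3)) (auto intro: order_trans)
    finally show ?thesis using Cn(1) c by (simp add: B1_def)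
  qed
  have M_top: "(M z *\<^sub>v w) $ i = (transpose_mat (H z) *\<^sub>v w) $ i" if "w \<in> carrier_vec ?n" "i < l" for z w i
    using mat_mult_append[of "transpose_mat (H z)" l ?n "transpose_mat (Q z)" "k - 1" w]
      H_carr[of z] Q_carr[of z] that unfolding M by simp
  \<comment> \<open>large enough for all rows of \<open>M \<Phi>\<close>, and for the leading ones after the factor \<open>exp (- \<eta> t)\<close> is split off\<close>
  define B where "B = max B1 (Cl * K * Cl * B1)"
  have B: "0 \<le> B" "B1 \<le> B" "Cl * K * Cl * B1 \<le> B"
    using \<open>0 < B1\<close> by (auto simp: B_def)
  \<comment> \<open>the sum of \<open>n choose k\<close> minors, together with the cost of changing norms and of inverting \<open>M\<^bsup>(k)\<^esup>\<close>\<close>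
  define C where "C = Cr * (?r * (fact k * B ^ k) * Cr) / c5"
  have C: "0 \<le> C" using B Cr c by (simp add: C_def)
  have main: "N ?r (y t) \<le> C * exp (- \<eta> * t) * N ?r (y 0)"
    if a: "a \<in> \<Omega>" and y: "compound_solution k f (\<lambda>t. x t a) y" and t: "0 \<le> t" for a y t
  proof -
    define A where "A = (\<lambda>t. jacobian (f t) (at (x t a)))"
    have x_deriv: "((\<lambda>t. x t a) has_vector_derivative f s (x s a)) (at s within {0..})" if "s \<in> {0..}" for s
      using sol a that by (simp add: solution_map_def trajectory_def)
    have path_cont: "continuous_on {0..} (\<lambda>t. (t, x t a))"
      by (intro continuous_on_Pair continuous_on_id continuous_on_vector_derivative[OF x_deriv])
    have J_cont: "continuous_on ({0..} \<times> UNIV) (\<lambda>(t, z). jacobian (f t) (at z))"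
      using C1 by (simp add: C1_in_state_def)
    have A_cont: "continuous_on {0..} A"
      using continuous_on_compose2[OF J_cont path_cont] by (simp add: A_def image_subset_iff)
    obtain \<delta> where \<delta>: "\<And>j. \<delta> j 0 = axis (coord j) 1"
      "\<And>j t. 0 \<le> t \<Longrightarrow> (\<delta> j has_vector_derivative A t *v \<delta> j t) (at t within {0..})"
      using fundamental_solutions_exist[OF A_cont] by blast
    have var: "variational_solution f (\<lambda>t. x t a) (\<delta> j)" for j
      using \<delta>(2) by (simp add: variational_solution_def A_def)
    have \<delta>_bound: "norm (\<delta> j s) \<le> L" if "0 \<le> s" for j s
      using variational_solution_norm_le[OF C1 sol full_dim_manifold_subset_closure_interior[OF assms(4)]
          lip L a var that, of j] by (simp add: \<delta>(1))
    define \<Phi> where "\<Phi> = (\<lambda>t. Matrix.mat ?n ?n (\<lambda>(i, j). to_vec (\<delta> j t) $ i))"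
    have \<Phi>: "\<Phi> s \<in> carrier_mat ?n ?n" for s by (simp add: \<Phi>_def)
    have \<Phi>_col: "col (\<Phi> s) j = to_vec (\<delta> j s)" if "j < ?n" for s j
      using that by (intro eq_vecI) (auto simp: \<Phi>_def to_vec_def)
    have \<Phi>_entry: "\<Phi> s $$ (i, j) = vec_nth (\<delta> j s) (coord i)" if "i < ?n" "j < ?n" for s i j
      using that by (simp add: \<Phi>_def to_vec_index)
    have mult_\<Phi>: "(D * \<Phi> s) $$ (i, j) = (D *\<^sub>v to_vec (\<delta> j s)) $ i"
      if "D \<in> carrier_mat ?n ?n" "i < ?n" "j < ?n" for D s i j
      using that \<Phi>[of s] \<Phi>_col[of j s] by simp
    have y_eq: "y t = mult_compound k (\<Phi> t) *\<^sub>v y 0"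
    proof (rule compound_system_solution[where A = "\<lambda>t. to_mat (A t)"])
      show "((\<lambda>s. \<Phi> s $$ (i, j)) has_real_derivative (to_mat (A s) * \<Phi> s) $$ (i, j)) (at s within {0..})"
        if "0 \<le> s" "i < ?n" "j < ?n" for s i j
      proof -
        have "((\<lambda>s. vec_nth (\<delta> j s) (coord i)) has_vector_derivative vec_nth (A s *v \<delta> j s) (coord i))
            (at s within {0..})"
          using bounded_linear.has_vector_derivative[OF bounded_linear_vec_nth \<delta>(2)[OF that(1)]] .
        then show ?thesis
          using that by (simp add: mult_\<Phi> \<Phi>_entry to_vec_mult[symmetric] to_vec_index
              has_real_derivative_iff_has_vector_derivative)
      qed
      show "continuous_on {0..} (\<lambda>s. to_mat (A s) $$ (i, j))" if "i < ?n" "j < ?n" for i j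
        using that continuous_on_component[OF continuous_on_component[OF A_cont]] by (simp add: to_mat_def)
      show "\<Phi> 0 = 1\<^sub>m ?n"
        using bij_betw_imp_inj_on[OF bij_betw_coord[where 'n = 'n]]
        by (intro eq_matI) (auto simp: \<Phi>_entry \<Phi>[THEN carrier_matD(1)] \<Phi>[THEN carrier_matD(2)] \<delta>(1) axis_def inj_on_eq_iff)
      show "y s \<in> carrier_vec ?r" if "0 \<le> s" for s
        using y that by (simp add: compound_solution_def)
      show "((\<lambda>s. y s $ i) has_real_derivative (add_compound k (to_mat (A s)) *\<^sub>v y s) $ i) (at s within {0..})"
        if "0 \<le> s" "i < ?r" for s i
        using y that by (simp add: compound_solution_def A_def)
    qed (use \<Phi> t in auto)
    have y_carr: "y s \<in> carrier_vec ?r" if "0 \<le> s" for s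
      using y that by (simp add: compound_solution_def)
    define G where "G = M (x t a) * \<Phi> t"
    have G: "G \<in> carrier_mat ?n ?n" unfolding G_def by (rule mult_carrier_mat[OF M_carr \<Phi>])
    have G_entry: "\<bar>G $$ (i, j)\<bar> \<le> B" if "i < ?n" "j < ?n" for i j
      unfolding G_def mult_\<Phi>[OF M_carr that]
      using frame_bound[OF inv[OF a t] \<delta>_bound[OF t] that(1), of j] B by simp
    have G_row: "\<bar>G $$ (i, j)\<bar> \<le> B * exp (- \<eta> * t)" if "i < l" "j < ?n" for i j
    proof -
      let ?P = "\<lambda>s. transpose_mat (H (x s a)) *\<^sub>v to_vec (\<delta> j s)"
      have i: "i < ?n" using that k by simp
      have P: "?P s \<in> carrier_vec l" for s
        using H_carr[of "x s a"] by (intro mult_mat_vec_carrier[of _ _ ?n]) simp_all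
      have "\<bar>?P 0 $ m\<bar> \<le> B1" if "m < l" for m
        using frame_bound[OF inv[OF a order_refl] \<delta>_bound[OF order_refl], of m j]
          M_top[OF carrier_to_vec that] that k(2) by simp
      then have P0: "N l (?P 0) \<le> Cl * B1"
        using \<open>0 < B1\<close> by (intro Cl(3) P) auto
      have "\<bar>G $$ (i, j)\<bar> = \<bar>?P t $ i\<bar>"
        unfolding G_def mult_\<Phi>[OF M_carr i that(2)] using M_top[OF carrier_to_vec that(1)] by simp
      also have "\<dots> \<le> Cl * N l (?P t)" using that(1) by (intro Cl(2) P)
      also have "\<dots> \<le> Cl * (K * exp (- \<eta> * t) * N l (?P 0))"
        using Cl(1) decay[OF a var t, of j] by simp
      also have "\<dots> \<le> Cl * (K * exp (- \<eta> * t) * (Cl * B1))"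
        using Cl(1) \<open>0 < K\<close> P0 by simp
      also have "\<dots> = (Cl * K * Cl * B1) * exp (- \<eta> * t)" by (simp add: mult_ac)
      also have "\<dots> \<le> B * exp (- \<eta> * t)" using B(3) by (intro mult_right_mono) auto
      finally show ?thesis .
    qed
    have Gk: "mult_compound k (M (x t a)) *\<^sub>v y t = mult_compound k G *\<^sub>v y 0"
      unfolding y_eq G_def mult_compound_mult[OF M_carr \<Phi>]
      using carrier_mult_compound[OF M_carr] carrier_mult_compound[OF \<Phi>] y_carr[OF order_refl]
      by (intro assoc_mult_mat_vec[symmetric])
    let ?\<beta> = "?r * (fact k * B ^ k * exp (- \<eta> * t)) * (Cr * N ?r (y 0))"
    have N0: "0 \<le> N ?r (y 0)" by (rule monotonic_norm_nonneg[OF N y_carr[OF order_refl]])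
    have "\<bar>(mult_compound k G *\<^sub>v y 0) $ i\<bar> \<le> ?\<beta>" if i: "i < ?r" for i
    proof -
      have "\<bar>(mult_compound k G *\<^sub>v y 0) $ i\<bar> \<le> (\<Sum>j<?r. \<bar>mult_compound k G $$ (i, j) * y 0 $ j\<bar>)"
        unfolding mult_mat_vec_index_sum[OF carrier_mult_compound[OF G] y_carr[OF order_refl] i]
        by (rule sum_abs)
      also have "\<dots> \<le> (\<Sum>j<?r. fact k * B ^ k * exp (- \<eta> * t) * (Cr * N ?r (y 0)))"
        unfolding abs_mult
      proof (intro sum_mono mult_mono)
        fix j assume "j \<in> {..<?r}"
        then show "\<bar>mult_compound k G $$ (i, j)\<bar> \<le> fact k * B ^ k * exp (- \<eta> * t)"
          using abs_mult_compound_le_small_rows[OF G B(1) G_entry G_row k(4,1) i] by simp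
        show "\<bar>y 0 $ j\<bar> \<le> Cr * N ?r (y 0)"
          using \<open>j \<in> {..<?r}\<close> by (intro Cr(2) y_carr) auto
      qed (use B in auto)
      finally show ?thesis by simp
    qed
    then have "N ?r (mult_compound k G *\<^sub>v y 0) \<le> Cr * ?\<beta>"
      using B N0 Cr(1) mult_mat_vec_carrier[OF carrier_mult_compound[OF G] y_carr[OF order_refl]]
      by (intro Cr(3)) auto
    then have "c5 * N ?r (y t) \<le> Cr * ?\<beta>"
      using Mk_bounds[OF inv[OF a t] y_carr[OF t]] unfolding Gk by linarith
    then show ?thesis
      using c by (simp add: C_def field_simps)
  qed
  have "N ?r (y t) \<le> max 1 C * exp (- \<eta> * t) * N ?r (y 0)"
    if "a \<in> \<Omega>" and y: "compound_solution k f (\<lambda>t. x t a) y" and "0 \<le> t" for a y t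
  proof -
    have "0 \<le> N ?r (y 0)"
      using y by (intro monotonic_norm_nonneg[OF N]) (simp add: compound_solution_def)
    then have "C * exp (- \<eta> * t) * N ?r (y 0) \<le> max 1 C * exp (- \<eta> * t) * N ?r (y 0)"
      by (intro mult_right_mono) auto
    then show ?thesis using main[OF that] by linarith
  qed
  then show ?thesis
    unfolding k_contractive_def using N[of ?r] \<open>0 < \<eta>\<close>
    by (intro exI[of _ "max 1 C"] exI[of _ \<eta>] exI[of _ "N ?r"] conjI) auto
qed

end
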